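(* Let $0<t<\pi/2$, let $\omega_1=E(1)>0$ and $\omega_2=E(i)\in i\mathbb{R}$, where $E(z)=\int_0^z \frac{du}{\sqrt{u^4-2(\cos 2t)u^2+1}}$, and let $\omega_3=\omega_1+\omega_2$. Let $\wp$ be the Weierstrass $\wp$-function with primitive periods $2\omega_1,2\omega_2$ and put $e_i=\wp(\omega_i)$ for $i=1,2,3$. Then $$e_1=2-\tfrac23\cos 2t,\qquad e_2=-2-\tfrac23\cos 2t,\qquad e_3=\tfrac43\cos 2t .$$
   Context: $\mathbb{D}$ is the open unit disk. Note $u^4-2(\cos 2t)u^2+1=(u-e^{it})(u+e^{-it})(u+e^{it})(u-e^{-it})$; the square root in $E$ is the holomorphic branch on $\mathbb{D}$ equal to $1$ at $u=0$, and $E(1)$, $E(i)$ are computed along the straight segments from $0$ (so $E(1)$ is real and positive, $E(i)$ is purely imaginary with positive imaginary part). $E$ maps $\mathbb{D}$ conformally onto the rectangle with vertices $\pm\omega_3,\pm\overline{\omega_3}$. *)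

theory Defs
  imports "HOL-Complex_Analysis.Complex_Analysis"
begin

definition quartic :: "real \<Rightarrow> complex \<Rightarrow> complex" where
  "quartic t u = u ^ 4 - 2 * of_real (cos (2 * t)) * u ^ 2 + 1"

definition is_sqrt_branch :: "real \<Rightarrow> (complex \<Rightarrow> complex) \<Rightarrow> bool" where
  "is_sqrt_branch t s \<longleftrightarrow>
     s holomorphic_on ball 0 1 \<and> s 0 = 1 \<and> (\<forall>u\<in>ball 0 1. s u ^ 2 = quartic t u)"

lemma quartic_factor:
  "quartic t u = (1 - cis (2 * t) * u ^ 2) * (1 - cis (- (2 * t)) * u ^ 2)"
proof -
  have 1: "cis (2 * t) + cis (- (2 * t)) = 2 * of_real (cos (2 * t))"
    by (simp add: complex_eq_iff)
  have 2: "cis (2 * t) * cis (- (2 * t)) = 1"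
    by (simp add: cis_mult)
  have "(1 - cis (2 * t) * u ^ 2) * (1 - cis (- (2 * t)) * u ^ 2)
      = 1 - (cis (2 * t) + cis (- (2 * t))) * u ^ 2
          + (cis (2 * t) * cis (- (2 * t))) * u ^ 4"
    by algebra
  then show ?thesis
    unfolding 1 2 by (simp add: quartic_def)
qed

lemma Re_factor_pos:
  assumes "u \<in> ball 0 1"
  shows "0 < Re (1 - cis a * u ^ 2)"
proof -
  have "norm u < 1"
    using assms by simp
  then have "norm (cis a * u ^ 2) < 1"
    by (simp add: norm_mult norm_power power_less_one_iff)
  then show ?thesis
    using complex_Re_le_cmod[of "cis a * u ^ 2"] by simp
qed

lemma quartic_nonzero:
  assumes "u \<in> ball 0 1"
  shows "quartic t u \<noteq> 0"
proof -
  have "1 - cis a * u ^ 2 \<noteq> 0" for a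
    using Re_factor_pos[OF assms, of a] by (metis less_irrefl zero_complex.sel(1))
  then show ?thesis
    unfolding quartic_factor by simp
qed

lemma is_sqrt_branch_exists: "\<exists>s. is_sqrt_branch t s"
proof -
  define s where
    "s u = csqrt (1 - cis (2 * t) * u ^ 2) * csqrt (1 - cis (- (2 * t)) * u ^ 2)" for u
  have "1 - cis a * u ^ 2 \<notin> \<real>\<^sub>\<le>\<^sub>0" if "u \<in> ball 0 1" for a u
    using Re_factor_pos[OF that, of a] by (auto simp: complex_nonpos_Reals_iff)
  then have "s holomorphic_on ball 0 1"
    unfolding s_def by (intro holomorphic_intros) auto
  moreover have "s u ^ 2 = quartic t u" for u
    by (simp add: s_def quartic_factor power_mult_distrib)
  moreover have "s 0 = 1"
    by (simp add: s_def)
  ultimately show ?thesis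
    unfolding is_sqrt_branch_def by blast
qed

lemma is_sqrt_branch_unique:
  assumes 1: "is_sqrt_branch t s" and 2: "is_sqrt_branch t r" and u: "u \<in> ball 0 1"
  shows "s u = r u"
proof -
  have nz: "r v \<noteq> 0" if "v \<in> ball 0 1" for v
  proof -
    have "r v ^ 2 = quartic t v"
      using 2 that by (simp add: is_sqrt_branch_def)
    then show ?thesis
      using quartic_nonzero[OF that, of t] by auto
  qed
  have val: "s v / r v \<in> {1, -1}" if "v \<in> ball 0 1" for v
  proof -
    have "s v ^ 2 = r v ^ 2"
      using 1 2 that by (simp add: is_sqrt_branch_def)
    then show ?thesis
      using nz[OF that] by (auto simp: power2_eq_iff)
  qed
  have "continuous_on (ball 0 1) (\<lambda>v. s v / r v)"
    using 1 2 nz unfolding is_sqrt_branch_def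
    by (intro continuous_on_divide) (auto intro: holomorphic_on_imp_continuous_on)
  moreover have "finite ((\<lambda>v. s v / r v) ` ball 0 1)"
    by (rule finite_subset[of _ "{1, -1}"], rule image_subsetI, erule val) simp
  ultimately have "(\<lambda>v. s v / r v) constant_on ball 0 1"
    by (intro continuous_finite_range_constant) auto
  then have "s u / r u = s 0 / r 0"
    using u unfolding constant_on_def by force
  then show ?thesis
    using 1 2 nz[OF u] by (simp add: is_sqrt_branch_def)
qed

text \<open>The branch is determined on the open disk only. For \<open>\<bar>z\<bar> = 1\<close> the arbitrary value at the
  endpoint of the segment does not affect the integral below.\<close>

definition sqrt_branch :: "real \<Rightarrow> complex \<Rightarrow> complex" where
  "sqrt_branch t = (SOME s. is_sqrt_branch t s)"

definition E :: "real \<Rightarrow> complex \<Rightarrow> complex" where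
  "E t z = contour_integral (linepath 0 z) (\<lambda>u. 1 / sqrt_branch t u)"

definition period_lattice :: "complex \<Rightarrow> complex \<Rightarrow> complex set" where
  "period_lattice a b = {of_int m * a + of_int n * b | m n. True}"

text \<open>Here \<open>a\<close> and \<open>b\<close> are the full primitive periods, not the half-periods. The value at lattice
  points, where the function has its poles, is meaningless.\<close>

definition weierstrass_p :: "complex \<Rightarrow> complex \<Rightarrow> complex \<Rightarrow> complex" where
  "weierstrass_p a b z =
     1 / z ^ 2 + (\<Sum>\<^sub>\<infinity>w \<in> period_lattice a b - {0}. (1 / (z - w) ^ 2 - 1 / w ^ 2))"

end

theory Submission
  imports Defs
begin

text \<open>The function \<open>E\<close> extends continuously to the closed disk. On the unit circle
  \<open>(e\<^sup>i\<^sup>\<theta> / \<surd>quartic)\<^sup>2 = 1 / (2 cos 2\<theta> - 2 cos 2t)\<close> is real, so \<open>E(e\<^sup>i\<^sup>\<theta>)\<close> moves vertically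
  for \<open>\<bar>\<theta>\<bar> < t\<close> and horizontally for \<open>t < \<theta> < \<pi> - t\<close>; hence \<open>E\<close> maps the circle into the boundary
  of the rectangle with vertices \<open>\<plusminus>\<omega>\<^sub>1 \<plusminus> \<omega>\<^sub>2\<close>, and \<open>E(e\<^sup>i\<^sup>t) = \<omega>\<^sub>1 + \<omega>\<^sub>2\<close>. By the symmetries of \<open>\<wp>\<close>,
  it is real on that boundary, as is \<open>u\<^sup>2 + u\<^sup>-\<^sup>2\<close> on the circle. Therefore
  \<open>\<wp>(E(u)) - u\<^sup>2 - u\<^sup>-\<^sup>2\<close>, which has a removable singularity at \<open>0\<close>, has vanishing imaginary part
  on the circle and is constant by the maximum principle. The expansion
  \<open>E(u) = u + (cos 2t / 3) u\<^sup>3 + \<dots>\<close> gives the constant \<open>- (2/3) cos 2t\<close>, and evaluation at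
  \<open>u = 1, \<i>, e\<^sup>i\<^sup>t\<close> gives the half-period values.\<close>

section \<open>The Weierstrass function of a rectangular lattice\<close>

lemma summable_on_int_powr:
  "(\<lambda>m::int. (1 + \<bar>real_of_int m\<bar>) powr (-3/2)) summable_on UNIV"
proof -
  have *: "(\<lambda>n::nat. (1 + real n) powr (-3/2)) summable_on UNIV"
  proof (rule summable_nonneg_imp_summable_on)
    have "summable (\<lambda>n. real (Suc n) powr (-3/2))"
      by (subst summable_Suc_iff) (simp add: summable_real_powr_iff)
    then show "summable (\<lambda>n. (1 + real n) powr (-3/2))"
      by (simp add: add.commute)
  qed auto
  have pos: "(\<lambda>m::int. (1 + \<bar>real_of_int m\<bar>) powr (-3/2)) summable_on (range int)"
    using * by (subst summable_on_reindex) (auto simp: o_def)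
  have neg: "(\<lambda>m::int. (1 + \<bar>real_of_int m\<bar>) powr (-3/2)) summable_on (range (\<lambda>n. - int n))"
    using * by (subst summable_on_reindex) (auto simp: o_def inj_def)
  have "range int \<union> range (\<lambda>n. - int n) = UNIV"
    by (auto intro: int_cases2)
  then show ?thesis
    using summable_on_union[OF pos neg] by simp
qed

text \<open>The majorant is a product of two convergent one-dimensional series. It dominates the
  inverse cubes of lattice norms up to a constant, so no count of lattice points in shells is
  required.\<close>

lemma summable_on_int_pairs:
  "(\<lambda>(m, n). ((1 + \<bar>real_of_int m\<bar>) * (1 + \<bar>real_of_int n\<bar>)) powr (-3/2)) summable_on (UNIV \<times> UNIV)"
proof -
  obtain S where S: "((\<lambda>m::int. (1 + \<bar>real_of_int m\<bar>) powr (-3/2)) has_sum S) UNIV"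
    using summable_on_int_powr summable_on_def by blast
  show ?thesis
  proof (rule summable_on_SigmaI)
    fix m :: int
    show "((\<lambda>n. case (m, n) of (m, n) \<Rightarrow>
        ((1 + \<bar>real_of_int m\<bar>) * (1 + \<bar>real_of_int n\<bar>)) powr (-3/2)) has_sum
        (1 + \<bar>real_of_int m\<bar>) powr (-3/2) * S) UNIV"
      using has_sum_cmult_right[OF S, of "(1 + \<bar>real_of_int m\<bar>) powr (-3/2)"]
      by (simp add: powr_mult)
    show "(\<lambda>m. (1 + \<bar>real_of_int m\<bar>) powr (-3/2) * S) summable_on (UNIV :: int set)"
      by (rule summable_on_cmult_left[OF summable_on_int_powr])
  qed auto
qed

text \<open>The parameters are half-periods: the full periods are \<open>2 * p\<close> and
  \<open>2 * \<i> * q\<close>.\<close>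

locale rectangular_lattice =
  fixes p q :: real
  assumes p_pos: "p > 0" and q_pos: "q > 0"
begin

definition lattice :: "complex set" where
  "lattice = period_lattice (2 * of_real p) (2 * (\<i> * of_real q))"

definition wp :: "complex \<Rightarrow> complex" where
  "wp = weierstrass_p (2 * of_real p) (2 * (\<i> * of_real q))"

text \<open>An open neighbourhood of the closed rectangle with corners +-p +- iq that contains no
  lattice point other than 0. The factor 3/2 leaves a margin to the next lattice points, whose
  coordinates are at least 2p or 2q.\<close>

definition wide_rectangle :: "complex set" where
  "wide_rectangle = {z. \<bar>Re z\<bar> < 3 / 2 * p \<and> \<bar>Im z\<bar> < 3 / 2 * q}"

text \<open>This is \<open>wp\<close> with its double pole at 0 removed.\<close>

definition regular_part :: "complex \<Rightarrow> complex" where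
  "regular_part z = (\<Sum>\<^sub>\<infinity>w \<in> lattice - {0}. (1 / (z - w) ^ 2 - 1 / w ^ 2))"

lemma lattice_eq:
  "lattice = range (\<lambda>(m, n). Complex (2 * p * of_int m) (2 * q * of_int n))"
proof -
  have "of_int m * (2 * of_real p) + of_int n * (2 * (\<i> * of_real q))
      = Complex (2 * p * of_int m) (2 * q * of_int n)" for m n
    by (simp add: complex_eq_iff)
  then show ?thesis
    unfolding lattice_def period_lattice_def by (auto simp: image_iff)
qed

lemma latticeE:
  assumes "w \<in> lattice"
  obtains m n :: int where "w = Complex (2 * p * of_int m) (2 * q * of_int n)"
  using assms unfolding lattice_eq by auto

lemma latticeI: "Complex (2 * p * of_int m) (2 * q * of_int n) \<in> lattice"
  unfolding lattice_eq by (rule image_eqI[of _ _ "(m, n)"]) auto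

lemma zero_in_lattice: "0 \<in> lattice"
  using latticeI[of 0 0] by (simp add: zero_complex.code)

lemma diff_in_lattice:
  assumes "v \<in> lattice" "w \<in> lattice"
  shows "v - w \<in> lattice"
proof -
  obtain a b c d :: int where
    v: "v = Complex (2 * p * of_int a) (2 * q * of_int b)" and
    w: "w = Complex (2 * p * of_int c) (2 * q * of_int d)"
    by (meson assms latticeE)
  have "v - w = Complex (2 * p * of_int (a - c)) (2 * q * of_int (b - d))"
    unfolding v w by (simp add: complex_eq_iff algebra_simps)
  then show ?thesis
    using latticeI by metis
qed

lemma uminus_in_lattice: "w \<in> lattice \<Longrightarrow> - w \<in> lattice"
  using diff_in_lattice[OF zero_in_lattice] by simp

lemma cnj_in_lattice:
  assumes "w \<in> lattice"
  shows "cnj w \<in> lattice"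
proof -
  obtain a b :: int where w: "w = Complex (2 * p * of_int a) (2 * q * of_int b)"
    by (meson assms latticeE)
  have "cnj w = Complex (2 * p * of_int a) (2 * q * of_int (- b))"
    unfolding w by (simp add: complex_eq_iff)
  then show ?thesis
    using latticeI by metis
qed

lemma periods_in_lattice: "2 * of_real p \<in> lattice" "2 * (\<i> * of_real q) \<in> lattice"
proof -
  have "2 * of_real p = Complex (2 * p * of_int 1) (2 * q * of_int 0)"
    "2 * (\<i> * of_real q) = Complex (2 * p * of_int 0) (2 * q * of_int 1)"
    by (simp_all add: complex_eq_iff)
  then show "2 * of_real p \<in> lattice" "2 * (\<i> * of_real q) \<in> lattice"
    using latticeI by metis+
qed

text \<open>All lattice symmetries used below (negation, conjugation, w to a - w) are
  involutions.\<close>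

lemma bij_betw_lattice:
  assumes "\<And>w. w \<in> lattice \<Longrightarrow> f w \<in> lattice" "\<And>w. f (f w) = w"
  shows "bij_betw f lattice lattice"
  by (rule bij_betw_byWitness[where f' = f]) (use assms in auto)

section \<open>Lattice estimates and holomorphy of the regular part\<close>

text \<open>The geometric mean is at most the larger factor 1 + |k|, and 1 + |k| <= 2|k| because the
  larger index is at least 1 in absolute value. The factor 2 is supplied by the periods 2p and
  2q.\<close>

lemma norm_lattice_point:
  assumes "(m, n) \<noteq> (0, 0)"
  shows "norm (Complex (2 * p * of_int m) (2 * q * of_int n))
     \<ge> min p q * sqrt ((1 + \<bar>real_of_int m\<bar>) * (1 + \<bar>real_of_int n\<bar>))"
proof -
  define r where "r = max (1 + \<bar>real_of_int m\<bar>) (1 + \<bar>real_of_int n\<bar>)"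
  let ?w = "Complex (2 * p * of_int m) (2 * q * of_int n)"
  have r1: "sqrt ((1 + \<bar>real_of_int m\<bar>) * (1 + \<bar>real_of_int n\<bar>)) \<le> r"
  proof (rule real_le_lsqrt)
    show "(1 + \<bar>real_of_int m\<bar>) * (1 + \<bar>real_of_int n\<bar>) \<le> r ^ 2"
      unfolding power2_eq_square r_def by (intro mult_mono) auto
  qed (auto simp: r_def)
  have re: "2 * p * \<bar>real_of_int m\<bar> \<le> norm ?w" and im: "2 * q * \<bar>real_of_int n\<bar> \<le> norm ?w"
    using abs_Re_le_cmod[of ?w] abs_Im_le_cmod[of ?w] p_pos q_pos by (auto simp: abs_mult)
  have "min p q * r \<le> norm ?w"
  proof (cases "\<bar>m\<bar> \<ge> \<bar>n\<bar>")
    case True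
    then have "\<bar>real_of_int m\<bar> \<ge> \<bar>real_of_int n\<bar>" "\<bar>real_of_int m\<bar> \<ge> 1"
      using assms by auto
    then have "r \<le> 2 * \<bar>real_of_int m\<bar>" by (simp add: r_def)
    then have "min p q * r \<le> p * (2 * \<bar>real_of_int m\<bar>)"
      using p_pos q_pos by (intro mult_mono) (auto simp: r_def)
    then show ?thesis using re by simp
  next
    case False
    then have "\<bar>real_of_int n\<bar> \<ge> \<bar>real_of_int m\<bar>" "\<bar>real_of_int n\<bar> \<ge> 1"
      by linarith+
    then have "r \<le> 2 * \<bar>real_of_int n\<bar>" by (simp add: r_def)
    then have "min p q * r \<le> q * (2 * \<bar>real_of_int n\<bar>)"
      using p_pos q_pos by (intro mult_mono) (auto simp: r_def)
    then show ?thesis using im by simp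
  qed
  moreover have "min p q * sqrt ((1 + \<bar>real_of_int m\<bar>) * (1 + \<bar>real_of_int n\<bar>)) \<le> min p q * r"
    using r1 p_pos q_pos by (intro mult_left_mono) auto
  ultimately show ?thesis by linarith
qed

lemma norm_lattice_ge:
  assumes "w \<in> lattice - {0}"
  shows "norm w \<ge> min p q"
proof -
  obtain a b :: int where w: "w = Complex (2 * p * of_int a) (2 * q * of_int b)"
    by (meson assms latticeE DiffD1)
  have "(a, b) \<noteq> (0, 0)"
    using assms w by (auto simp: complex_eq_iff)
  note norm_lattice_point[OF this]
  moreover have "sqrt ((1 + \<bar>real_of_int a\<bar>) * (1 + \<bar>real_of_int b\<bar>)) \<ge> 1"
    by (simp add: algebra_simps)
  then have "min p q * 1 \<le> min p q * sqrt ((1 + \<bar>real_of_int a\<bar>) * (1 + \<bar>real_of_int b\<bar>))"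
    using p_pos q_pos by (intro mult_left_mono) auto
  ultimately show ?thesis using w by simp
qed

lemma summable_lattice_inverse_cube: "(\<lambda>w. 1 / norm w ^ 3) summable_on (lattice - {0})"
proof -
  let ?\<phi> = "\<lambda>(m, n). Complex (2 * p * of_int m) (2 * q * of_int n)"
  have inj: "inj_on ?\<phi> (UNIV - {(0, 0)})"
    using p_pos q_pos by (auto simp: inj_on_def)
  have img: "lattice - {0} = ?\<phi> ` (UNIV - {(0, 0)})"
    using p_pos q_pos unfolding lattice_eq by (auto simp: complex_eq_iff image_iff)
  have bound: "1 / norm (?\<phi> x) ^ 3 \<le> 1 / min p q ^ 3 *
      (case x of (m, n) \<Rightarrow> ((1 + \<bar>real_of_int m\<bar>) * (1 + \<bar>real_of_int n\<bar>)) powr (-3/2))"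
    if "x \<in> UNIV - {(0, 0)}" for x
  proof -
    obtain m n where x: "x = (m, n)" by force
    define s where "s = (1 + \<bar>real_of_int m\<bar>) * (1 + \<bar>real_of_int n\<bar>)"
    have s: "s > 0" unfolding s_def by (intro mult_pos_pos) auto
    have "min p q * sqrt s \<le> norm (?\<phi> x)"
      using norm_lattice_point[of m n] that unfolding x s_def by simp
    then have "(min p q * sqrt s) ^ 3 \<le> norm (?\<phi> x) ^ 3"
      using p_pos q_pos s by (intro power_mono) auto
    then have "1 / norm (?\<phi> x) ^ 3 \<le> 1 / (min p q * sqrt s) ^ 3"
      using p_pos q_pos s by (intro frac_le zero_less_power mult_pos_pos) auto
    also have "sqrt s ^ 3 = s powr (3/2)"
      using s by (simp add: powr_half_sqrt[symmetric] powr_realpow[symmetric] powr_powr)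
    then have "1 / (min p q * sqrt s) ^ 3 = 1 / min p q ^ 3 * s powr (-3/2)"
      using s by (simp add: power_mult_distrib powr_minus divide_simps)
    finally show ?thesis by (simp add: x s_def)
  qed
  have "(\<lambda>x. 1 / norm (?\<phi> x) ^ 3) summable_on (UNIV - {(0, 0)})"
  proof (rule summable_on_comparison_test)
    show "(\<lambda>x. 1 / min p q ^ 3 * (case x of (m, n) \<Rightarrow>
        ((1 + \<bar>real_of_int m\<bar>) * (1 + \<bar>real_of_int n\<bar>)) powr (-3/2))) summable_on (UNIV - {(0, 0)})"
      using summable_on_int_pairs
      by (intro summable_on_cmult_right summable_on_subset_banach[OF summable_on_int_pairs]) auto
  qed (use bound in auto)
  then show ?thesis
    unfolding img by (subst summable_on_reindex[OF inj]) (simp add: o_def)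
qed

lemma summable_lattice_majorant: "(\<lambda>w. C / norm w ^ 3) summable_on (lattice - {0})"
  using summable_on_cmult_right[OF summable_lattice_inverse_cube, of C] by simp

text \<open>Coordinatewise: for k nonzero, |x| < 3r/2 is at most three quarters of |2rk|, so at
  least one quarter of |2rk| survives the subtraction.\<close>

lemma dist_lattice_ge:
  assumes "z \<in> wide_rectangle" "w \<in> lattice"
  shows "norm (z - w) \<ge> norm w / 4"
proof -
  obtain a b :: int where w: "w = Complex (2 * p * of_int a) (2 * q * of_int b)"
    by (meson assms latticeE)
  have aux: "\<bar>x - 2 * r * of_int k\<bar> \<ge> \<bar>2 * r * of_int k / 4\<bar>" if "r > 0" "\<bar>x\<bar> < 3 / 2 * r"
    for x r :: real and k :: int
  proof (cases "k = 0")
    case False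
    then have "\<bar>real_of_int k\<bar> \<ge> 1" by linarith
    then have "r * \<bar>real_of_int k\<bar> \<ge> r * 1" using that by (intro mult_left_mono) auto
    moreover have "\<bar>r * real_of_int k\<bar> = r * \<bar>real_of_int k\<bar>"
      using that by (simp add: abs_mult)
    ultimately show ?thesis using that by linarith
  qed simp
  have "norm (w / 4) \<le> norm (z - w)"
    unfolding cmod_def
    using aux[OF p_pos, of "Re z" a] aux[OF q_pos, of "Im z" b] assms(1)
    by (intro real_sqrt_le_mono add_mono) (auto simp: w wide_rectangle_def abs_le_square_iff[symmetric])
  then show ?thesis by (simp add: norm_divide)
qed

text \<open>Over a common denominator the leading terms cancel and the numerator is z(2w - z), which
  grows only linearly in w against a denominator of order four.\<close>

lemma lattice_term_bound:
  obtains C where "\<And>z w. z \<in> wide_rectangle \<Longrightarrow> w \<in> lattice - {0} \<Longrightarrow>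
     norm (1 / (z - w) ^ 2 - 1 / w ^ 2) \<le> C / norm w ^ 3"
proof -
  define R where "R = 3 / 2 * p + 3 / 2 * q"
  \<comment> \<open>The 16 comes from squaring the 1/4 in \<open>dist_lattice_ge\<close>. The last
    factor comes from |2w - z| <= 2|w| + |z| with |z| <= R <= (R / min p q) |w|.\<close>
  define C where "C = 16 * R * (2 + R / min p q)"
  have "norm (1 / (z - w) ^ 2 - 1 / w ^ 2) \<le> C / norm w ^ 3"
    if z: "z \<in> wide_rectangle" and w: "w \<in> lattice - {0}" for z w
  proof -
    have m: "min p q > 0" using p_pos q_pos by simp
    have R: "R > 0" using p_pos q_pos by (simp add: R_def)
    have wn: "norm w > 0" using w by simp
    have zw: "norm w / 4 \<le> norm (z - w)" using dist_lattice_ge z w by blast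
    then have zw0: "z - w \<noteq> 0" using wn by auto
    have zR: "norm z \<le> R"
      using cmod_le[of z] z unfolding wide_rectangle_def R_def by auto
    also have "R = R / min p q * min p q" using m by (simp del: min_less_iff_conj)
    also have "\<dots> \<le> R / min p q * norm w"
      using norm_lattice_ge[OF w] R m by (intro mult_left_mono) auto
    finally have zRw: "norm z \<le> R / min p q * norm w" .
    have "1 / (z - w) ^ 2 - 1 / w ^ 2 = z * (2 * w - z) / ((z - w) ^ 2 * w ^ 2)"
      using zw0 w by (simp add: divide_simps) (simp add: power2_eq_square algebra_simps)
    then have "norm (1 / (z - w) ^ 2 - 1 / w ^ 2)
        = norm z * norm (2 * w - z) / (norm (z - w) ^ 2 * norm w ^ 2)"
      by (simp add: norm_mult norm_divide norm_power)
    also have "\<dots> \<le> R * ((2 + R / min p q) * norm w) / ((norm w / 4) ^ 2 * norm w ^ 2)"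
    proof (intro frac_le mult_mono power_mono)
      have "norm (2 * w - z) \<le> 2 * norm w + norm z"
        using norm_triangle_ineq4[of "2 * w" z] by (simp add: norm_mult)
      then show "norm (2 * w - z) \<le> (2 + R / min p q) * norm w"
        using zRw by (simp add: algebra_simps)
    qed (use zR zw wn R m in auto)
    also have "\<dots> = C / norm w ^ 3"
      using wn by (simp add: C_def divide_simps power2_eq_square power3_eq_cube)
    finally show ?thesis .
  qed
  then show ?thesis using that by blast
qed

text \<open>The M-test gives uniform convergence of the finite partial sums, each holomorphic on the
  wide rectangle. The limit theorem works on discs, hence the detour through analyticity.\<close>

lemma regular_part_holomorphic: "regular_part holomorphic_on wide_rectangle"
proof -
  obtain C where C: "\<And>z w. z \<in> wide_rectangle \<Longrightarrow> w \<in> lattice - {0} \<Longrightarrow>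
     norm (1 / (z - w) ^ 2 - 1 / w ^ 2) \<le> C / norm w ^ 3"
    using lattice_term_bound by metis
  have lim: "uniform_limit wide_rectangle (\<lambda>X z. \<Sum>w\<in>X. 1 / (z - w) ^ 2 - 1 / w ^ 2) regular_part
     (finite_subsets_at_top (lattice - {0}))"
    unfolding regular_part_def[abs_def]
    by (rule Weierstrass_m_test_general[where M = "\<lambda>w. C / norm w ^ 3"])
       (use C summable_lattice_majorant in auto)
  have hol: "(\<lambda>z. \<Sum>w\<in>X. 1 / (z - w) ^ 2 - 1 / w ^ 2) holomorphic_on wide_rectangle"
    if "X \<subseteq> lattice - {0}" for X
  proof -
    have "z - w \<noteq> 0 \<and> w \<noteq> 0" if "w \<in> X" "z \<in> wide_rectangle" for z w
      using dist_lattice_ge[of z w] that \<open>X \<subseteq> lattice - {0}\<close> by fastforce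
    then show ?thesis
      by (intro holomorphic_intros) auto
  qed
  have opn: "open wide_rectangle"
    unfolding wide_rectangle_def by (intro open_Collect_conj open_Collect_less continuous_intros)
  have "regular_part analytic_on wide_rectangle"
    unfolding analytic_on_def
  proof
    fix z assume "z \<in> wide_rectangle"
    then obtain r where r: "r > 0" "cball z r \<subseteq> wide_rectangle"
      using opn open_contains_cball by blast
    have "regular_part holomorphic_on ball z r"
    proof (rule holomorphic_uniform_limit)
      show "uniform_limit (cball z r) (\<lambda>X z. \<Sum>w\<in>X. 1 / (z - w) ^ 2 - 1 / w ^ 2) regular_part
         (finite_subsets_at_top (lattice - {0}))"
        using lim r by (blast intro: uniform_limit_on_subset)
      show "\<forall>\<^sub>F X in finite_subsets_at_top (lattice - {0}).
          continuous_on (cball z r) (\<lambda>z. \<Sum>w\<in>X. 1 / (z - w) ^ 2 - 1 / w ^ 2) \<and>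
          (\<lambda>z. \<Sum>w\<in>X. 1 / (z - w) ^ 2 - 1 / w ^ 2) holomorphic_on ball z r"
      proof (rule eventually_finite_subsets_at_top_weakI)
        fix X assume "finite X" "X \<subseteq> lattice - {0}"
        then have *: "(\<lambda>z. \<Sum>w\<in>X. 1 / (z - w) ^ 2 - 1 / w ^ 2) holomorphic_on cball z r"
          using hol r by (blast intro: holomorphic_on_subset)
        then show "continuous_on (cball z r) (\<lambda>z. \<Sum>w\<in>X. 1 / (z - w) ^ 2 - 1 / w ^ 2) \<and>
          (\<lambda>z. \<Sum>w\<in>X. 1 / (z - w) ^ 2 - 1 / w ^ 2) holomorphic_on ball z r"
          by (meson ball_subset_cball holomorphic_on_imp_continuous_on holomorphic_on_subset)
      qed
    qed auto
    then show "\<exists>e>0. regular_part holomorphic_on ball z e" using r by blast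
  qed
  then show ?thesis by (rule analytic_imp_holomorphic)
qed

lemma regular_part_zero: "regular_part 0 = 0"
  unfolding regular_part_def by simp

lemma wp_eq_regular_part: "wp z = 1 / z ^ 2 + regular_part z"
  unfolding wp_def weierstrass_p_def regular_part_def lattice_def ..

text \<open>With the convention \<open>1 / 0 = 0\<close>, the summand for \<open>w = 0\<close> is \<open>1 / z ^ 2\<close>, so that the sum
  over the punctured lattice becomes a sum over the whole lattice, invariant under translations.\<close>

lemma wp_has_sum:
  assumes "z \<in> wide_rectangle"
  shows "((\<lambda>w. 1 / (z - w) ^ 2 - 1 / w ^ 2) has_sum wp z) lattice"
proof -
  obtain C where C: "\<And>z w. z \<in> wide_rectangle \<Longrightarrow> w \<in> lattice - {0} \<Longrightarrow>
     norm (1 / (z - w) ^ 2 - 1 / w ^ 2) \<le> C / norm w ^ 3"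
    using lattice_term_bound by metis
  have "(\<lambda>w. 1 / (z - w) ^ 2 - 1 / w ^ 2) summable_on (lattice - {0})"
    using C[OF assms]
    by (intro abs_summable_summable[OF summable_on_comparison_test[OF summable_lattice_majorant[of C]]]) auto
  then have "((\<lambda>w. 1 / (z - w) ^ 2 - 1 / w ^ 2) has_sum regular_part z) (lattice - {0})"
    unfolding regular_part_def by (rule has_sum_infsum)
  from has_sum_insert[OF _ this, of 0] show ?thesis
    by (simp add: wp_eq_regular_part insert_absorb zero_in_lattice)
qed

section \<open>Symmetries of the Weierstrass function and its real values\<close>

lemma wp_reindex:
  assumes "z \<in> wide_rectangle" and "\<And>w. w \<in> lattice \<Longrightarrow> f w \<in> lattice" "\<And>w. f (f w) = w"
  shows "((\<lambda>w. 1 / (z - f w) ^ 2 - 1 / f w ^ 2) has_sum wp z) lattice"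
  using wp_has_sum[OF assms(1)]
    has_sum_reindex_bij_betw[OF bij_betw_lattice[of f, OF assms(2,3)], of "\<lambda>w. 1 / (z - w) ^ 2 - 1 / w ^ 2"]
  by simp

lemma wp_minus:
  assumes "z \<in> wide_rectangle"
  shows "wp (- z) = wp z"
proof -
  have "- z \<in> wide_rectangle" using assms by (simp add: wide_rectangle_def)
  from wp_reindex[OF this, of uminus]
  have "((\<lambda>w. 1 / (- z + w) ^ 2 - 1 / w ^ 2) has_sum wp (- z)) lattice"
    by (simp add: uminus_in_lattice)
  moreover have "(- z + w) ^ 2 = (z - w) ^ 2" for w
    by (simp add: power2_eq_square algebra_simps)
  ultimately show ?thesis
    using wp_has_sum[OF assms] by (simp add: has_sum_unique)
qed

lemma wp_cnj:
  assumes "z \<in> wide_rectangle"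
  shows "wp (cnj z) = cnj (wp z)"
proof -
  have "cnj z \<in> wide_rectangle" using assms by (simp add: wide_rectangle_def)
  from wp_reindex[OF this, of cnj]
  have "((\<lambda>w. 1 / (cnj z - cnj w) ^ 2 - 1 / cnj w ^ 2) has_sum wp (cnj z)) lattice"
    by (simp add: cnj_in_lattice)
  then have "((\<lambda>w. cnj (1 / (z - w) ^ 2 - 1 / w ^ 2)) has_sum wp (cnj z)) lattice"
    by simp
  moreover have "((\<lambda>w. cnj (1 / (z - w) ^ 2 - 1 / w ^ 2)) has_sum cnj (wp z)) lattice"
    using wp_has_sum[OF assms] by (simp only: has_sum_cnj_iff)
  ultimately show ?thesis by (rule has_sum_unique)
qed

text \<open>After the substitution \<open>w \<mapsto> a - w\<close> the difference \<open>wp (a - z) - wp z\<close> is the sum of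
  \<open>1 / w ^ 2 - 1 / (a - w) ^ 2\<close>, which changes sign under the same substitution.\<close>

lemma wp_reflect:
  assumes "z \<in> wide_rectangle" "a - z \<in> wide_rectangle" "a \<in> lattice"
  shows "wp (a - z) = wp z"
proof -
  have f: "a - w \<in> lattice" if "w \<in> lattice" for w
    using diff_in_lattice assms(3) that by blast
  have "((\<lambda>w. 1 / (a - z - (a - w)) ^ 2 - 1 / (a - w) ^ 2) has_sum wp (a - z)) lattice"
    using wp_reindex[OF assms(2), of "\<lambda>w. a - w"] f by simp
  moreover have "(a - z - (a - w)) ^ 2 = (z - w) ^ 2" for w
    by (simp add: power2_eq_square algebra_simps)
  ultimately have "((\<lambda>w. 1 / (z - w) ^ 2 - 1 / (a - w) ^ 2) has_sum wp (a - z)) lattice"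
    by simp
  from has_sum_add[OF this has_sum_uminusI[OF wp_has_sum[OF assms(1)]]]
  have D: "((\<lambda>w. 1 / w ^ 2 - 1 / (a - w) ^ 2) has_sum wp (a - z) - wp z) lattice"
    by simp
  then have "((\<lambda>w. 1 / (a - w) ^ 2 - 1 / (a - (a - w)) ^ 2) has_sum wp (a - z) - wp z) lattice"
    using has_sum_reindex_bij_betw[OF bij_betw_lattice[of "\<lambda>w. a - w"],
        of "\<lambda>w. 1 / w ^ 2 - 1 / (a - w) ^ 2"] f by simp
  from has_sum_add[OF D this] have "((\<lambda>w. 0) has_sum 2 * (wp (a - z) - wp z)) lattice"
    by simp
  then have "2 * (wp (a - z) - wp z) = 0"
    using has_sum_0[of lattice "\<lambda>w. 0 :: complex"] has_sum_unique by blast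
  then show ?thesis by simp
qed

text \<open>On the line Re z = p, conjugation agrees with the reflection z to 2p - z, which leaves
  \<open>wp\<close> unchanged.\<close>

lemma wp_real_on_vertical_side:
  assumes "Re z = p" "\<bar>Im z\<bar> \<le> q"
  shows "wp z \<in> \<real>"
proof -
  have z: "z \<in> wide_rectangle" and z': "2 * of_real p - z \<in> wide_rectangle"
    using assms p_pos q_pos by (auto simp: wide_rectangle_def)
  have "cnj z = 2 * of_real p - z"
    using assms by (simp add: complex_eq_iff)
  then have "cnj (wp z) = wp z"
    using wp_cnj[OF z] wp_reflect[OF z z' periods_in_lattice(1)] by simp
  then show ?thesis by (simp add: Reals_cnj_iff)
qed

text \<open>Here conjugation is the reflection z to 2iq - z followed by negation, so evenness enters
  as well.\<close>

lemma wp_real_on_horizontal_side: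
  assumes "Im z = q" "\<bar>Re z\<bar> \<le> p"
  shows "wp z \<in> \<real>"
proof -
  have z: "z \<in> wide_rectangle" and z': "2 * (\<i> * of_real q) - z \<in> wide_rectangle"
    using assms p_pos q_pos by (auto simp: wide_rectangle_def)
  have "cnj z = - (2 * (\<i> * of_real q) - z)"
    using assms by (simp add: complex_eq_iff)
  then have "cnj (wp z) = wp z"
    using wp_cnj[OF z] wp_reflect[OF z z' periods_in_lattice(2)] wp_minus[OF z'] by simp
  then show ?thesis by (simp add: Reals_cnj_iff)
qed

end

section \<open>The elliptic integral on the closed disk\<close>

text \<open>By uniqueness this agrees with \<open>sqrt_branch\<close> on the open disk. In contrast
  to that choice, it also has definite values on the unit circle and continues holomorphically
  across it away from the roots of the quartic.\<close>

definition sqrt_quartic :: "real \<Rightarrow> complex \<Rightarrow> complex" where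
  "sqrt_quartic t u = csqrt (1 - cis (2 * t) * u ^ 2) * csqrt (1 - cis (- (2 * t)) * u ^ 2)"

text \<open>The plane cut along the radial rays from the roots of the quartic, which are the four
  points +-exp(+-it), to infinity.\<close>

definition slit_plane :: "real \<Rightarrow> complex set" where
  "slit_plane t = {u. 1 - cis (2 * t) * u ^ 2 \<notin> \<real>\<^sub>\<le>\<^sub>0 \<and> 1 - cis (- (2 * t)) * u ^ 2 \<notin> \<real>\<^sub>\<le>\<^sub>0}"

text \<open>The contour integral of \<open>E\<close> along the segment from 0 to u, with the
  explicit branch and written over a real parameter.\<close>

definition elliptic_integral :: "real \<Rightarrow> complex \<Rightarrow> complex" where
  "elliptic_integral t u = integral {0..1} (\<lambda>x. u / sqrt_quartic t (of_real x * u))"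

lemma sqrt_quartic_power2: "sqrt_quartic t u ^ 2 = quartic t u"
  by (simp add: sqrt_quartic_def quartic_factor power_mult_distrib)

lemma sqrt_quartic_zero: "sqrt_quartic t 0 = 1"
  by (simp add: sqrt_quartic_def)

lemma sqrt_quartic_minus: "sqrt_quartic t (- u) = sqrt_quartic t u"
  by (simp add: sqrt_quartic_def)

lemma ball_subset_slit_plane: "ball 0 1 \<subseteq> slit_plane t"
proof
  fix u :: complex assume "u \<in> ball 0 1"
  from Re_factor_pos[OF this, of "2 * t"] Re_factor_pos[OF this, of "- (2 * t)"]
  show "u \<in> slit_plane t" by (simp add: slit_plane_def complex_nonpos_Reals_iff)
qed

lemma sqrt_quartic_holomorphic: "sqrt_quartic t holomorphic_on slit_plane t"
  unfolding sqrt_quartic_def[abs_def] slit_plane_def by (intro holomorphic_intros) auto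

lemma sqrt_quartic_nonzero: "u \<in> slit_plane t \<Longrightarrow> sqrt_quartic t u \<noteq> 0"
  unfolding sqrt_quartic_def slit_plane_def by auto

lemma scale_in_ball:
  fixes u :: complex
  assumes "norm u \<le> 1" "0 \<le> x" "x < 1"
  shows "of_real x * u \<in> ball 0 1"
proof -
  have "x * norm u \<le> x * 1" using assms by (intro mult_left_mono) auto
  then have "x * norm u < 1" using assms by linarith
  then show ?thesis using assms by (simp add: norm_mult)
qed

lemma sqrt_branch_eq:
  assumes "u \<in> ball 0 1"
  shows "sqrt_branch t u = sqrt_quartic t u"
proof -
  have "is_sqrt_branch t (sqrt_branch t)"
    unfolding sqrt_branch_def using is_sqrt_branch_exists by (rule someI_ex)
  moreover have "is_sqrt_branch t (sqrt_quartic t)"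
    using sqrt_quartic_holomorphic ball_subset_slit_plane
    by (auto simp: is_sqrt_branch_def sqrt_quartic_power2 sqrt_quartic_zero
        intro: holomorphic_on_subset)
  ultimately show ?thesis
    using is_sqrt_branch_unique assms by blast
qed

lemma E_eq_elliptic_integral:
  assumes "norm z \<le> 1"
  shows "E t z = elliptic_integral t z"
proof -
  have "E t z = integral {0..1} (\<lambda>x. 1 / sqrt_branch t (of_real x * z) * z)"
    unfolding E_def contour_integral_integral
    by (rule integral_cong) (simp add: linepath_def scaleR_conv_of_real)
  also have "\<dots> = elliptic_integral t z"
    unfolding elliptic_integral_def
  proof (rule integral_spike)
    \<comment> \<open>For z on the circle, the arbitrary value of \<open>sqrt_branch\<close> enters
      only at the endpoint x = 1.\<close>
    show "negligible {1 :: real}" by simp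
    fix x :: real assume x: "x \<in> {0..1} - {1}"
    have "of_real x * z \<in> ball 0 1"
      using x assms by (intro scale_in_ball) auto
    then show "z / sqrt_quartic t (of_real x * z) = 1 / sqrt_branch t (of_real x * z) * z"
      by (simp add: sqrt_branch_eq)
  qed
  finally show ?thesis .
qed

lemma open_slit_plane: "open (slit_plane t)"
proof -
  have "open ((\<lambda>u. 1 - cis a * u ^ 2) -` (- \<real>\<^sub>\<le>\<^sub>0))" for a
    by (intro open_vimage open_Compl closed_nonpos_Reals_complex continuous_intros)
  moreover have "slit_plane t = (\<lambda>u. 1 - cis (2 * t) * u ^ 2) -` (- \<real>\<^sub>\<le>\<^sub>0)
      \<inter> (\<lambda>u. 1 - cis (- (2 * t)) * u ^ 2) -` (- \<real>\<^sub>\<le>\<^sub>0)"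
    by (auto simp: slit_plane_def)
  ultimately show ?thesis by (simp add: open_Int)
qed

text \<open>The cuts run radially outwards: if x^2 w is real and at least 1 with 0 <= x <= 1, then
  so is w. Hence the slit plane is starlike about 0.\<close>

lemma slit_plane_scale:
  assumes u: "u \<in> slit_plane t" and x: "0 \<le> x" "x \<le> 1"
  shows "of_real x * u \<in> slit_plane t"
proof -
  have "1 - cis a * (of_real x * u) ^ 2 \<notin> \<real>\<^sub>\<le>\<^sub>0" if "1 - cis a * u ^ 2 \<notin> \<real>\<^sub>\<le>\<^sub>0" for a
  proof
    define w where "w = cis a * u ^ 2"
    have eq: "cis a * (of_real x * u) ^ 2 = of_real (x ^ 2) * w"
      by (simp add: w_def power_mult_distrib)
    assume "1 - cis a * (of_real x * u) ^ 2 \<in> \<real>\<^sub>\<le>\<^sub>0"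
    then have 1: "x ^ 2 * Re w \<ge> 1" and 2: "x ^ 2 * Im w = 0"
      unfolding eq complex_nonpos_Reals_iff by auto
    have "x ^ 2 \<le> 1" using x by (simp add: power_le_one)
    have "Re w > 0"
      using 1 by (smt (verit) mult_nonneg_nonpos zero_le_power2)
    then have "x ^ 2 * Re w \<le> 1 * Re w"
      using \<open>x ^ 2 \<le> 1\<close> by (intro mult_right_mono) auto
    then have "Re w \<ge> 1" using 1 by simp
    \<comment> \<open>The bound x^2 Re w >= 1 rules out x = 0.\<close>
    moreover have "Im w = 0" using 1 2 by auto
    ultimately have "1 - w \<in> \<real>\<^sub>\<le>\<^sub>0" by (simp add: complex_nonpos_Reals_iff)
    then show False using that by (simp add: w_def)
  qed
  then show ?thesis using u by (simp add: slit_plane_def)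
qed

lemma closed_segment_slit_plane:
  assumes "u \<in> slit_plane t"
  shows "closed_segment 0 u \<subseteq> slit_plane t"
  using slit_plane_scale[OF assms] by (auto simp: closed_segment_def scaleR_conv_of_real)

text \<open>On a starlike open set the integrand has a primitive g, and the radial integral is g v -
  g 0. The slit plane reaches beyond the disk, so this also permits differentiation along the open
  arcs of the circle.\<close>

lemma elliptic_integral_has_field_derivative:
  assumes "u \<in> slit_plane t"
  shows "(elliptic_integral t has_field_derivative 1 / sqrt_quartic t u) (at u)"
proof -
  have zero: "0 \<in> slit_plane t" by (simp add: slit_plane_def)
  have hol: "(\<lambda>u. 1 / sqrt_quartic t u) holomorphic_on slit_plane t"
    using sqrt_quartic_nonzero by (intro holomorphic_intros sqrt_quartic_holomorphic) auto
  have "\<exists>g. \<forall>x \<in> slit_plane t. (g has_field_derivative 1 / sqrt_quartic t x) (at x)"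
  proof (rule holomorphic_starlike_primitive[where k = "{}"])
    show "starlike (slit_plane t)"
      unfolding starlike_def using zero closed_segment_slit_plane by blast
    show "(\<lambda>u. 1 / sqrt_quartic t u) field_differentiable at x" if "x \<in> slit_plane t - {}" for x
      using hol that open_slit_plane holomorphic_on_imp_differentiable_at by auto
  qed (use hol open_slit_plane in \<open>auto intro: holomorphic_on_imp_continuous_on\<close>)
  then obtain g where g: "\<And>x. x \<in> slit_plane t \<Longrightarrow> (g has_field_derivative 1 / sqrt_quartic t x) (at x)"
    by blast
  have eq: "elliptic_integral t v = g v - g 0" if "v \<in> slit_plane t" for v
  proof -
    have "((\<lambda>u. 1 / sqrt_quartic t u) has_contour_integral g (pathfinish (linepath 0 v)) - g (pathstart (linepath 0 v)))
        (linepath 0 v)"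
      by (rule contour_integral_primitive[where S = "slit_plane t"])
        (use g closed_segment_slit_plane[OF that] in
          \<open>simp_all add: has_field_derivative_at_within del: linepath_0\<close>)
    then have "((\<lambda>x. v / sqrt_quartic t (of_real x * v)) has_integral g v - g 0) {0..1}"
      unfolding has_contour_integral_linepath pathfinish_linepath pathstart_linepath
      by (simp add: linepath_def scaleR_conv_of_real)
    then show ?thesis
      unfolding elliptic_integral_def by (rule integral_unique)
  qed
  have "((\<lambda>v. g v - g 0) has_field_derivative 1 / sqrt_quartic t u) (at u)"
    using DERIV_diff[OF g[OF assms] DERIV_const[of "g 0"]] by simp
  then show ?thesis
    using assms open_slit_plane eq
    by (subst DERIV_cong_ev[OF refl _ refl, where g = "\<lambda>v. g v - g 0"])
      (auto intro: eventually_mono[OF eventually_nhds_in_open])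
qed

lemma elliptic_integral_holomorphic: "elliptic_integral t holomorphic_on slit_plane t"
  using elliptic_integral_has_field_derivative open_slit_plane holomorphic_on_open by blast

lemma elliptic_integral_zero: "elliptic_integral t 0 = 0"
  by (simp add: elliptic_integral_def)

lemma elliptic_integral_minus: "elliptic_integral t (- u) = - elliptic_integral t u"
  by (simp add: elliptic_integral_def sqrt_quartic_minus flip: integral_neg)

text \<open>Conjugation of u exchanges the two factors up to conjugation, and \<open>csqrt\<close>
  commutes with \<open>cnj\<close> off the cut.\<close>

lemma sqrt_quartic_cnj:
  assumes "u \<in> ball 0 1"
  shows "sqrt_quartic t (cnj u) = cnj (sqrt_quartic t u)"
proof -
  have "1 - cis a * u ^ 2 \<notin> \<real>\<^sub>\<le>\<^sub>0" for a
    using Re_factor_pos[OF assms, of a] by (auto simp: complex_nonpos_Reals_iff)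
  from cnj_csqrt[OF this[of "2 * t"]] cnj_csqrt[OF this[of "- (2 * t)"]] show ?thesis
    unfolding sqrt_quartic_def by (simp add: cis_cnj)
qed

lemma elliptic_integral_cnj:
  assumes "norm u \<le> 1"
  shows "elliptic_integral t (cnj u) = cnj (elliptic_integral t u)"
  unfolding elliptic_integral_def integral_cnj
proof (rule integral_spike)
  show "negligible {1 :: real}" by simp
  fix x :: real assume x: "x \<in> {0..1} - {1}"
  have "of_real x * u \<in> ball 0 1"
    using x assms by (intro scale_in_ball) auto
  from sqrt_quartic_cnj[OF this]
  show "cnj (u / sqrt_quartic t (of_real x * u)) = cnj u / sqrt_quartic t (of_real x * cnj u)"
    by simp
qed

text \<open>Both radicands lie in the right half-plane, so both roots lie in the sector |arg| < pi/4
  and their product is again in the right half-plane.\<close>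

lemma Re_sqrt_quartic_pos:
  assumes "u \<in> ball 0 1"
  shows "Re (sqrt_quartic t u) > 0"
proof -
  have *: "\<bar>Im (csqrt A)\<bar> < Re (csqrt A)" if "Re A > 0" for A
  proof -
    have "Re (csqrt A ^ 2) > 0" using that by simp
    then have "(Im (csqrt A)) ^ 2 < (Re (csqrt A)) ^ 2"
      by (simp only: power2_eq_square times_complex.sel)
    moreover have "Re (csqrt A) \<ge> 0" using csqrt_principal[of A] by auto
    ultimately show ?thesis by (metis abs_le_square_iff abs_of_nonneg not_le)
  qed
  define A where "A = csqrt (1 - cis (2 * t) * u ^ 2)"
  define B where "B = csqrt (1 - cis (- (2 * t)) * u ^ 2)"
  have A: "\<bar>Im A\<bar> < Re A" and B: "\<bar>Im B\<bar> < Re B"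
    unfolding A_def B_def by (intro * Re_factor_pos[OF assms])+
  have "\<bar>Im A\<bar> * \<bar>Im B\<bar> < Re A * Re B"
    using A B by (intro mult_strict_mono) auto
  then have "Im A * Im B < Re A * Re B"
    by (metis abs_ge_self abs_mult le_less_trans)
  then show ?thesis
    by (simp add: sqrt_quartic_def A_def B_def)
qed

text \<open>A maximum at an interior point would force a zero derivative. This form avoids
  determining the sign of the derivative, of which only non-vanishing is established along the
  arcs.\<close>

lemma le_max_endpoints:
  fixes f :: "real \<Rightarrow> real"
  assumes cont: "continuous_on {a..b} f"
    and deriv: "\<And>x. a < x \<Longrightarrow> x < b \<Longrightarrow> \<exists>y. (f has_real_derivative y) (at x) \<and> y \<noteq> 0"
    and x: "a \<le> x" "x \<le> b"
  shows "f x \<le> max (f a) (f b)"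
proof -
  obtain m where m: "m \<in> {a..b}" "\<And>y. y \<in> {a..b} \<Longrightarrow> f y \<le> f m"
    using continuous_attains_sup[OF _ _ cont] x by auto
  have "\<not> (a < m \<and> m < b)"
  proof
    assume ab: "a < m \<and> m < b"
    then obtain y where y: "(f has_real_derivative y) (at m)" "y \<noteq> 0"
      using deriv by blast
    have "y = 0"
    proof (rule DERIV_local_max[OF y(1), of "min (m - a) (b - m)"])
      show "\<forall>z. \<bar>m - z\<bar> < min (m - a) (b - m) \<longrightarrow> f z \<le> f m"
        by (intro allI impI m(2)) auto
    qed (use ab in auto)
    then show False using y(2) by simp
  qed
  then have "m = a \<or> m = b" using m(1) by auto
  then show ?thesis using m(2)[of x] x by auto
qed

section \<open>Continuity and positivity on the closed disk\<close>

locale quartic_angle =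
  fixes t :: real
  assumes t_pos: "0 < t" and t_less: "t < pi / 2"
begin

lemma sin_2t_pos: "sin (2 * t) > 0"
  using t_pos t_less by (intro sin_gt_zero) auto

text \<open>The two factors of the quartic cannot be small simultaneously.\<close>

lemma norm_sqrt_quartic_ge:
  assumes u: "norm u \<le> 1" and x: "0 \<le> x" "x < 1"
  shows "norm (sqrt_quartic t (of_real x * u)) \<ge> sqrt (sin (2 * t) * (1 - x))"
proof -
  define w where "w = (of_real x * u) ^ 2"
  define A where "A = 1 - cis (2 * t) * w"
  define B where "B = 1 - cis (- (2 * t)) * w"
  have "norm w \<le> x"
  proof -
    have "x * norm u \<le> x * 1" using u x by (intro mult_left_mono) auto
    then have "norm w \<le> x ^ 2"
      using x by (simp add: w_def norm_mult norm_power power_mono)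
    also have "\<dots> \<le> x" using x by (simp add: power2_eq_square mult_left_le)
    finally show ?thesis .
  qed
  then have lower: "1 - x \<le> norm (1 - cis a * w)" for a
    using norm_triangle_ineq2[of 1 "cis a * w"] by (simp add: norm_mult)
  \<comment> \<open>This combination eliminates w and leaves a constant of modulus 2 sin 2t, so one
    of |A|, |B| is at least sin 2t. The other is at least 1 - x.\<close>
  have "cis (- (2 * t)) * A - cis (2 * t) * B = cis (- (2 * t)) - cis (2 * t)"
    unfolding A_def B_def right_diff_distrib mult.assoc[symmetric] cis_mult by simp
  also have "\<dots> = - 2 * \<i> * of_real (sin (2 * t))"
    by (simp add: complex_eq_iff)
  finally have "norm (cis (- (2 * t)) * A - cis (2 * t) * B) = 2 * sin (2 * t)"
    using sin_2t_pos by (simp add: norm_mult)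
  then have "2 * sin (2 * t) \<le> norm A + norm B"
    using norm_triangle_ineq4[of "cis (- (2 * t)) * A" "cis (2 * t) * B"] by (simp add: norm_mult)
  then consider "norm A \<ge> sin (2 * t)" | "norm B \<ge> sin (2 * t)" by linarith
  then have "sin (2 * t) * (1 - x) \<le> norm A * norm B"
  proof cases
    case 1
    then show ?thesis
      using sin_2t_pos x lower[of "- (2 * t)"] unfolding B_def by (intro mult_mono) auto
  next
    case 2
    then have "(1 - x) * sin (2 * t) \<le> norm A * norm B"
      using sin_2t_pos x lower[of "2 * t"] unfolding A_def by (intro mult_mono) auto
    then show ?thesis by (simp add: mult.commute)
  qed
  also have "norm A * norm B = norm (sqrt_quartic t (of_real x * u) ^ 2)"
    by (simp add: sqrt_quartic_power2 quartic_factor A_def B_def w_def norm_mult)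
  finally have "sin (2 * t) * (1 - x) \<le> norm (sqrt_quartic t (of_real x * u)) ^ 2"
    by (simp add: norm_power)
  then show ?thesis
    by (intro real_le_lsqrt) auto
qed

text \<open>Dominated convergence: the lower bound on the root gives an integrable majorant that is
  the same for all u in the closed disk, the branch points included.\<close>

lemma elliptic_integral_continuous: "continuous_on (cball 0 1) (elliptic_integral t)"
proof (rule continuous_on_sequentiallyI)
  fix v :: "nat \<Rightarrow> complex" and a
  assume v: "\<forall>n. v n \<in> cball 0 1" and a: "a \<in> cball 0 1" and lim: "v \<longlonglongrightarrow> a"
  \<comment> \<open>Setting both \<open>h\<close> and \<open>F\<close> to 0 at x = 1 makes the bound
    hold on all of [0, 1] without changing the integrals.\<close>
  define h where "h = (\<lambda>x::real. if x = 1 then 0 else 1 / sqrt (sin (2 * t) * (1 - x)))"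
  define F where "F = (\<lambda>u (x::real). if x = 1 then 0 else u / sqrt_quartic t (of_real x * u))"
  have ell: "elliptic_integral t u = integral {0..1} (F u)" for u
    unfolding elliptic_integral_def F_def by (rule integral_spike[where S = "{1}"]) auto
  have h: "h integrable_on {0..1}"
  proof -
    have "((\<lambda>x. 1 / sqrt (sin (2 * t) * (1 - x))) has_integral
        (- 2 / sqrt (sin (2 * t)) * sqrt (1 - 1)) - (- 2 / sqrt (sin (2 * t)) * sqrt (1 - 0))) {0..1}"
    \<comment> \<open>The antiderivative is continuous on [0, 1] but not differentiable at
      1.\<close>
    proof (rule fundamental_theorem_of_calculus_interior)
      fix x :: real assume "x \<in> {0<..<1}"
      then show "((\<lambda>x. - 2 / sqrt (sin (2 * t)) * sqrt (1 - x)) has_vector_derivative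
          1 / sqrt (sin (2 * t) * (1 - x))) (at x)"
        unfolding has_real_derivative_iff_has_vector_derivative[symmetric]
        using sin_2t_pos
        by (auto intro!: derivative_eq_intros simp: real_sqrt_mult divide_simps)
    qed (use sin_2t_pos in \<open>auto intro!: continuous_intros\<close>)
    then show ?thesis
      by (intro integrable_spike_finite[of "{1}" _ h]) (auto simp: h_def has_integral_integrable)
  qed
  have in_ball: "of_real x * u \<in> ball 0 1" if "u \<in> cball 0 1" "0 \<le> x" "x < 1" for u :: complex and x
    using that by (intro scale_in_ball) auto
  have bound: "norm (F u x) \<le> h x" if u: "u \<in> cball 0 1" and x: "x \<in> {0..1}" for u x
  proof (cases "x = 1")
    case False
    have "norm u / norm (sqrt_quartic t (of_real x * u)) \<le> 1 / sqrt (sin (2 * t) * (1 - x))"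
      using u x False sin_2t_pos norm_sqrt_quartic_ge[of u x] by (intro frac_le) auto
    then show ?thesis using False by (simp add: F_def h_def norm_divide)
  qed (simp add: F_def h_def)
  have contin: "continuous_on (ball 0 1) (\<lambda>u. 1 / sqrt_quartic t u)"
    using sqrt_quartic_holomorphic[of t] ball_subset_slit_plane[of t] sqrt_quartic_nonzero[of _ t]
    by (intro continuous_intros holomorphic_on_imp_continuous_on[OF holomorphic_on_subset]) auto
  have integrable: "F u integrable_on {0..1}" if u: "u \<in> cball 0 1" for u
  proof (rule measurable_bounded_by_integrable_imp_integrable[OF _ h])
    have "continuous_on {0..<1} (\<lambda>x. u * (1 / sqrt_quartic t (of_real x * u)))"
      using in_ball[OF u] by (intro continuous_on_mult_left continuous_on_compose2[OF contin]
          continuous_intros) auto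
    then have "(\<lambda>x. u * (1 / sqrt_quartic t (of_real x * u))) \<in> borel_measurable (lebesgue_on {0..<1})"
      by (intro continuous_imp_measurable_on_sets_lebesgue) auto
    \<comment> \<open>Since \<open>F u\<close> vanishes at 1, extension by zero from [0, 1) and from
      [0, 1] gives the same function.\<close>
    then have "(\<lambda>x. if x \<in> {0..<1} then u * (1 / sqrt_quartic t (of_real x * u)) else 0)
        \<in> borel_measurable lebesgue"
      by (subst borel_measurable_if) auto
    then have "(\<lambda>x. if x \<in> {0..1} then F u x else 0) \<in> borel_measurable lebesgue"
      by (rule back_subst[of "\<lambda>f. f \<in> borel_measurable lebesgue"]) (auto simp: F_def fun_eq_iff)
    then show "F u \<in> borel_measurable (lebesgue_on {0..1})"
      by (subst (asm) borel_measurable_if) auto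
  qed (use bound[OF u] in auto)
  have "(\<lambda>n. integral {0..1} (F (v n))) \<longlonglongrightarrow> integral {0..1} (F a)"
  proof (rule dominated_convergence(2)[OF _ h])
    fix x :: real assume x: "x \<in> {0..1}"
    show "(\<lambda>n. F (v n) x) \<longlonglongrightarrow> F a x"
    proof (cases "x = 1")
      case False
      have "(\<lambda>n. 1 / sqrt_quartic t (of_real x * v n)) \<longlonglongrightarrow> 1 / sqrt_quartic t (of_real x * a)"
        using v a x False in_ball
        by (intro continuous_on_tendsto_compose[OF contin] tendsto_intros lim always_eventually) auto
      from tendsto_mult[OF lim this] show ?thesis
        using False by (simp add: F_def)
    qed (simp add: F_def)
  qed (use v integrable bound in auto)
  then show "(\<lambda>n. elliptic_integral t (v n)) \<longlonglongrightarrow> elliptic_integral t a"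
    by (simp add: ell)
qed

text \<open>Along the segment from 0 to u, the derivative of E(xu)/u in x is the reciprocal of the
  root, which has positive real part. This yields the positivity of both half-periods and shows that
  E vanishes only at 0.\<close>

lemma Re_elliptic_integral_div_pos:
  assumes "u \<in> cball 0 1" "u \<noteq> 0"
  shows "Re (elliptic_integral t u / u) > 0"
proof -
  define \<phi> where "\<phi> = (\<lambda>x. Re (elliptic_integral t (of_real x * u) / u))"
  have in_cball: "of_real x * u \<in> cball 0 1" if "0 \<le> x" "x \<le> 1" for x
    using that assms by (auto simp: norm_mult intro: mult_le_one)
  have "\<phi> 0 < \<phi> 1"
  proof (rule DERIV_pos_imp_increasing_open[where a = 0 and b = 1 and f = \<phi>])
    have "continuous_on {0..1} (\<lambda>x. elliptic_integral t (of_real x * u))"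
      by (rule continuous_on_compose2[OF elliptic_integral_continuous])
        (use in_cball in \<open>auto intro!: continuous_intros\<close>)
    then show "continuous_on {0..1} \<phi>"
      unfolding \<phi>_def using assms by (intro continuous_intros) auto
    fix x :: real assume x: "0 < x" "x < 1"
    then have ball: "of_real x * u \<in> ball 0 1" using assms by (intro scale_in_ball) auto
    then have slit: "of_real x * u \<in> slit_plane t" using ball_subset_slit_plane by blast
    have "((\<lambda>z. elliptic_integral t (z * u)) has_field_derivative
        1 / sqrt_quartic t (of_real x * u) * u) (at (of_real x))"
      by (rule DERIV_chain2[where g = "\<lambda>z. z * u", OF elliptic_integral_has_field_derivative[OF slit]])
        (auto intro!: derivative_eq_intros)
    from DERIV_cdivide[OF this, of u]
    have "((\<lambda>z. elliptic_integral t (z * u) / u) has_field_derivative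
        1 / sqrt_quartic t (of_real x * u)) (at (of_real x))"
      using assms by simp
    then have "((\<lambda>x. elliptic_integral t (of_real x * u) / u) has_vector_derivative
        1 / sqrt_quartic t (of_real x * u)) (at x)"
      by (rule has_vector_derivative_real_field)
    then have "(\<phi> has_vector_derivative Re (1 / sqrt_quartic t (of_real x * u))) (at x)"
      unfolding \<phi>_def by (rule bounded_linear.has_vector_derivative[OF bounded_linear_Re])
    then have "DERIV \<phi> x :> Re (1 / sqrt_quartic t (of_real x * u))"
      by (simp add: has_real_derivative_iff_has_vector_derivative)
    moreover have "Re (1 / sqrt_quartic t (of_real x * u)) > 0"
      using Re_sqrt_quartic_pos[OF ball, of t] Re_complex_div_gt_0[of 1 "sqrt_quartic t (of_real x * u)"]
      by auto
    ultimately show "\<exists>y. DERIV \<phi> x :> y \<and> y > 0" by blast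
  qed simp
  then show ?thesis by (simp add: \<phi>_def elliptic_integral_zero)
qed

section \<open>Derivatives along the unit circle\<close>

text \<open>A point of the circle can meet a cut only at its tip, where the unimodular number
  cis(2(theta +- t)) equals 1.\<close>

lemma cis_in_slit_plane:
  assumes "sin (\<theta> + t) \<noteq> 0" "sin (\<theta> - t) \<noteq> 0"
  shows "cis \<theta> \<in> slit_plane t"
proof -
  have *: "1 - cis (2 * a) * cis \<theta> ^ 2 \<notin> \<real>\<^sub>\<le>\<^sub>0" if "sin (\<theta> + a) \<noteq> 0" for a
  proof
    have eq: "cis (2 * a) * cis \<theta> ^ 2 = cis (2 * (\<theta> + a))"
      by (simp add: power2_eq_square cis_mult algebra_simps)
    assume "1 - cis (2 * a) * cis \<theta> ^ 2 \<in> \<real>\<^sub>\<le>\<^sub>0"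
    then have "cos (2 * (\<theta> + a)) \<ge> 1"
      unfolding eq complex_nonpos_Reals_iff by simp
    then have "(sin (\<theta> + a)) ^ 2 \<le> 0"
      unfolding cos_double_sin by simp
    then show False using that by simp
  qed
  show ?thesis
    using *[of t] *[of "- t"] assms by (simp add: slit_plane_def)
qed

lemma elliptic_integral_cis_has_vector_derivative:
  assumes "sin (\<theta> + t) \<noteq> 0" "sin (\<theta> - t) \<noteq> 0"
  shows "((\<lambda>\<theta>. elliptic_integral t (cis \<theta>)) has_vector_derivative
     \<i> * (cis \<theta> / sqrt_quartic t (cis \<theta>))) (at \<theta>)"
proof -
  have slit: "exp (\<i> * of_real \<theta>) \<in> slit_plane t"
    using cis_in_slit_plane[OF assms] by (simp add: cis_conv_exp)
  have "((\<lambda>z. elliptic_integral t (exp (\<i> * z))) has_field_derivative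
     \<i> * (exp (\<i> * of_real \<theta>) / sqrt_quartic t (exp (\<i> * of_real \<theta>)))) (at (of_real \<theta>))"
    by (rule DERIV_chain2[where g = "\<lambda>z. exp (\<i> * z)", THEN DERIV_cong,
          OF elliptic_integral_has_field_derivative[OF slit]])
      (auto intro!: derivative_eq_intros)
  then show ?thesis
    unfolding cis_conv_exp by (rule has_vector_derivative_real_field)
qed

lemma Re_Im_elliptic_integral_cis_derivative:
  assumes "sin (\<theta> + t) \<noteq> 0" "sin (\<theta> - t) \<noteq> 0"
  shows "((\<lambda>\<theta>. Re (elliptic_integral t (cis \<theta>))) has_real_derivative
     - Im (cis \<theta> / sqrt_quartic t (cis \<theta>))) (at \<theta>)"
   and "((\<lambda>\<theta>. Im (elliptic_integral t (cis \<theta>))) has_real_derivative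
     Re (cis \<theta> / sqrt_quartic t (cis \<theta>))) (at \<theta>)"
  using bounded_linear.has_vector_derivative[OF bounded_linear_Re
      elliptic_integral_cis_has_vector_derivative[OF assms]]
    bounded_linear.has_vector_derivative[OF bounded_linear_Im
      elliptic_integral_cis_has_vector_derivative[OF assms]]
  by (simp_all only: has_real_derivative_iff_has_vector_derivative Re_i_times Im_i_times)

text \<open>On the circle the quartic is cis(2 theta) times a real number, so this square is real.
  Its sign decides whether E moves vertically or horizontally.\<close>

lemma cis_div_sqrt_quartic_power2:
  "(cis \<theta> / sqrt_quartic t (cis \<theta>)) ^ 2 = of_real (- 1 / (4 * (sin (\<theta> + t) * sin (\<theta> - t))))"
proof -
  have "2 * cos (2 * \<theta>) - 2 * cos (2 * t) = - 4 * (sin (\<theta> + t) * sin (\<theta> - t))"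
    using cos_diff_cos[of "2 * \<theta>" "2 * t"] by (simp add: sin_times_sin field_simps)
  moreover have "quartic t (cis \<theta>) = cis \<theta> ^ 2 * of_real (2 * cos (2 * \<theta>) - 2 * cos (2 * t))"
  proof -
    have "cis \<theta> ^ 2 * (2 * of_real (cos (2 * \<theta>))) = cis (2 * \<theta>) * (cis (2 * \<theta>) + cis (- (2 * \<theta>)))"
      by (simp add: power2_eq_square cis_mult complex_eq_iff)
    also have "\<dots> = cis \<theta> ^ 4 + 1"
      by (simp add: distrib_left cis_mult Complex.DeMoivre)
    finally show ?thesis by (simp add: quartic_def algebra_simps)
  qed
  ultimately show ?thesis
    by (simp add: power_divide sqrt_quartic_power2 del: of_real_mult)
qed

lemma sin_signs_right_arc:
  assumes "\<bar>\<theta>\<bar> < t"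
  shows "sin (\<theta> + t) > 0" "sin (\<theta> - t) < 0"
proof -
  show "sin (\<theta> + t) > 0" using assms t_less by (intro sin_gt_zero) auto
  have "sin (t - \<theta>) > 0" using assms t_less by (intro sin_gt_zero) auto
  then show "sin (\<theta> - t) < 0" using sin_minus[of "t - \<theta>"] by simp
qed

lemma sin_signs_top_arc:
  assumes "t < \<theta>" "\<theta> < pi - t"
  shows "sin (\<theta> + t) > 0" "sin (\<theta> - t) > 0"
  using assms t_pos by (auto intro!: sin_gt_zero)

lemma cis_div_sqrt_quartic_right_arc:
  assumes "\<bar>\<theta>\<bar> < t"
  shows "Im (cis \<theta> / sqrt_quartic t (cis \<theta>)) = 0" "Re (cis \<theta> / sqrt_quartic t (cis \<theta>)) \<noteq> 0"
proof -
  define z where "z = cis \<theta> / sqrt_quartic t (cis \<theta>)"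
  have "sin (\<theta> + t) * sin (\<theta> - t) < 0"
    using sin_signs_right_arc[OF assms] by (rule mult_pos_neg)
  then have "- 1 / (4 * (sin (\<theta> + t) * sin (\<theta> - t))) > 0"
    by (intro divide_neg_neg) (auto simp: mult.commute)
  then have "Im (z ^ 2) = 0" "Re (z ^ 2) > 0"
    unfolding z_def cis_div_sqrt_quartic_power2 by simp_all
  then have "Im z = 0 \<and> Re z \<noteq> 0"
    by (auto simp: Re_power2 Im_power2)
  then show "Im (cis \<theta> / sqrt_quartic t (cis \<theta>)) = 0" "Re (cis \<theta> / sqrt_quartic t (cis \<theta>)) \<noteq> 0"
    by (simp_all add: z_def)
qed

lemma cis_div_sqrt_quartic_top_arc:
  assumes "t < \<theta>" "\<theta> < pi - t"
  shows "Re (cis \<theta> / sqrt_quartic t (cis \<theta>)) = 0" "Im (cis \<theta> / sqrt_quartic t (cis \<theta>)) \<noteq> 0"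
proof -
  define z where "z = cis \<theta> / sqrt_quartic t (cis \<theta>)"
  have "sin (\<theta> + t) * sin (\<theta> - t) > 0"
    using sin_signs_top_arc[OF assms] by (rule mult_pos_pos)
  then have "- 1 / (4 * (sin (\<theta> + t) * sin (\<theta> - t))) < 0"
    by (intro divide_neg_pos) auto
  then have "Im (z ^ 2) = 0" "Re (z ^ 2) < 0"
    unfolding z_def cis_div_sqrt_quartic_power2 by simp_all
  then have "Re z = 0 \<and> Im z \<noteq> 0"
    by (auto simp: Re_power2 Im_power2)
  then show "Re (cis \<theta> / sqrt_quartic t (cis \<theta>)) = 0" "Im (cis \<theta> / sqrt_quartic t (cis \<theta>)) \<noteq> 0"
    by (simp_all add: z_def)
qed

lemma continuous_on_elliptic_integral_cis: "continuous_on A (\<lambda>\<theta>. elliptic_integral t (cis \<theta>))"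
  by (intro continuous_on_compose2[OF elliptic_integral_continuous] continuous_intros) auto

section \<open>The half-periods and the image rectangle\<close>

definition p :: real where "p = Re (elliptic_integral t 1)"

definition q :: real where "q = Im (elliptic_integral t \<i>)"

lemma p_pos: "p > 0"
  using Re_elliptic_integral_div_pos[of 1] by (simp add: p_def)

lemma q_pos: "q > 0"
  using Re_elliptic_integral_div_pos[of \<i>] by (simp add: q_def Re_divide)

lemma elliptic_integral_one: "elliptic_integral t 1 = of_real p"
  using elliptic_integral_cnj[of 1 t] by (simp add: p_def complex_eq_iff)

text \<open>Conjugation and negation agree at \<open>\<i>\<close>, so the value equals minus its own
  conjugate.\<close>

lemma elliptic_integral_i: "elliptic_integral t \<i> = \<i> * of_real q"
  using elliptic_integral_cnj[of \<i> t] elliptic_integral_minus[of t \<i>]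
  by (simp add: q_def complex_eq_iff)

text \<open>The derivative of the real part vanishes inside the arc. Continuity on the closed disk
  carries the constant to the branch points at the ends, and theta = 0 identifies it.\<close>

lemma Re_elliptic_integral_right_arc:
  assumes "\<bar>\<theta>\<bar> \<le> t"
  shows "Re (elliptic_integral t (cis \<theta>)) = p"
proof -
  have const: "Re (elliptic_integral t (cis x)) = Re (elliptic_integral t (cis (- t)))" if "\<bar>x\<bar> \<le> t" for x
  proof (rule DERIV_isconst2[of "- t" t])
    show "continuous_on {- t..t} (\<lambda>\<theta>. Re (elliptic_integral t (cis \<theta>)))"
      by (intro continuous_intros continuous_on_elliptic_integral_cis)
    fix \<theta> assume "- t < \<theta>" "\<theta> < t"
    then have \<theta>: "\<bar>\<theta>\<bar> < t" by auto
    then show "((\<lambda>\<theta>. Re (elliptic_integral t (cis \<theta>))) has_real_derivative 0) (at \<theta>)"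
      using Re_Im_elliptic_integral_cis_derivative(1)[of \<theta>] sin_signs_right_arc[OF \<theta>]
        cis_div_sqrt_quartic_right_arc(1)[OF \<theta>] by simp
  qed (use t_pos that in auto)
  show ?thesis
    using const[OF assms] const[of 0] t_pos by (simp add: p_def)
qed

text \<open>The same argument for the imaginary part, with the constant read off at theta =
  pi/2.\<close>

lemma Im_elliptic_integral_top_arc:
  assumes "t \<le> \<theta>" "\<theta> \<le> pi - t"
  shows "Im (elliptic_integral t (cis \<theta>)) = q"
proof -
  have const: "Im (elliptic_integral t (cis x)) = Im (elliptic_integral t (cis t))"
    if "t \<le> x" "x \<le> pi - t" for x
  proof (rule DERIV_isconst2[of t "pi - t"])
    show "continuous_on {t..pi - t} (\<lambda>\<theta>. Im (elliptic_integral t (cis \<theta>)))"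
      by (intro continuous_intros continuous_on_elliptic_integral_cis)
    fix \<theta> assume \<theta>: "t < \<theta>" "\<theta> < pi - t"
    then show "((\<lambda>\<theta>. Im (elliptic_integral t (cis \<theta>))) has_real_derivative 0) (at \<theta>)"
      using Re_Im_elliptic_integral_cis_derivative(2)[of \<theta>] sin_signs_top_arc[OF \<theta>]
        cis_div_sqrt_quartic_top_arc(1)[OF \<theta>] by simp
  qed (use t_less that in auto)
  show ?thesis
    using const[OF assms] const[of "pi / 2"] t_pos t_less by (simp add: q_def cis_pi_half)
qed

text \<open>The point \<open>cis t\<close> is an end of both arcs, so both coordinates are known
  there.\<close>

lemma elliptic_integral_corner: "elliptic_integral t (cis t) = of_real p + \<i> * of_real q"
  using Re_elliptic_integral_right_arc[of t] Im_elliptic_integral_top_arc[of t] t_pos t_less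
  by (simp add: complex_eq_iff)

text \<open>The derivative of the imaginary part does not vanish inside the arc, so the maximum is
  attained at an end, where the values are +-q. Conjugation turns the upper bound into the lower
  one.\<close>

lemma abs_Im_elliptic_integral_right_arc:
  assumes "\<bar>\<theta>\<bar> \<le> t"
  shows "\<bar>Im (elliptic_integral t (cis \<theta>))\<bar> \<le> q"
proof -
  have corner: "elliptic_integral t (cis (- t)) = cnj (of_real p + \<i> * of_real q)"
    using elliptic_integral_cnj[of "cis t" t] by (simp add: cis_cnj elliptic_integral_corner)
  have upper: "Im (elliptic_integral t (cis x)) \<le> q" if "\<bar>x\<bar> \<le> t" for x
  proof -
    have "Im (elliptic_integral t (cis x)) \<le>
        max (Im (elliptic_integral t (cis (- t)))) (Im (elliptic_integral t (cis t)))"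
    proof (rule le_max_endpoints[where f = "\<lambda>\<theta>. Im (elliptic_integral t (cis \<theta>))"])
      show "continuous_on {- t..t} (\<lambda>\<theta>. Im (elliptic_integral t (cis \<theta>)))"
        by (intro continuous_intros continuous_on_elliptic_integral_cis)
      fix \<theta> assume "- t < \<theta>" "\<theta> < t"
      then have \<theta>: "\<bar>\<theta>\<bar> < t" by auto
      show "\<exists>y. ((\<lambda>\<theta>. Im (elliptic_integral t (cis \<theta>))) has_real_derivative y) (at \<theta>) \<and> y \<noteq> 0"
        using Re_Im_elliptic_integral_cis_derivative(2)[of \<theta>] sin_signs_right_arc[OF \<theta>]
          cis_div_sqrt_quartic_right_arc(2)[OF \<theta>] by (metis less_irrefl)
    qed (use that in auto)
    then show ?thesis
      using q_pos by (simp add: corner elliptic_integral_corner)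
  qed
  have "Im (elliptic_integral t (cis (- \<theta>))) = - Im (elliptic_integral t (cis \<theta>))"
    using elliptic_integral_cnj[of "cis \<theta>" t] by (simp add: cis_cnj)
  then show ?thesis
    using upper[of \<theta>] upper[of "- \<theta>"] assms by simp
qed

text \<open>As for the right arc, with the reflection u to -cnj u, that is theta to pi - theta, in
  place of conjugation.\<close>

lemma abs_Re_elliptic_integral_top_arc:
  assumes "t \<le> \<theta>" "\<theta> \<le> pi - t"
  shows "\<bar>Re (elliptic_integral t (cis \<theta>))\<bar> \<le> p"
proof -
  have reflect: "Re (elliptic_integral t (cis (pi - x))) = - Re (elliptic_integral t (cis x))" for x
  proof -
    have "cis (pi - x) = - cnj (cis x)" by (simp add: complex_eq_iff)
    then show ?thesis
      using elliptic_integral_cnj[of "cis x" t] elliptic_integral_minus[of t "cnj (cis x)"] by simp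
  qed
  have upper: "Re (elliptic_integral t (cis x)) \<le> p" if "t \<le> x" "x \<le> pi - t" for x
  proof -
    have "Re (elliptic_integral t (cis x)) \<le>
        max (Re (elliptic_integral t (cis t))) (Re (elliptic_integral t (cis (pi - t))))"
    proof (rule le_max_endpoints[where f = "\<lambda>\<theta>. Re (elliptic_integral t (cis \<theta>))"])
      show "continuous_on {t..pi - t} (\<lambda>\<theta>. Re (elliptic_integral t (cis \<theta>)))"
        by (intro continuous_intros continuous_on_elliptic_integral_cis)
      fix \<theta> assume \<theta>: "t < \<theta>" "\<theta> < pi - t"
      show "\<exists>y. ((\<lambda>\<theta>. Re (elliptic_integral t (cis \<theta>))) has_real_derivative y) (at \<theta>) \<and> y \<noteq> 0"
        using Re_Im_elliptic_integral_cis_derivative(1)[of \<theta>] sin_signs_top_arc[OF \<theta>]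
          cis_div_sqrt_quartic_top_arc(2)[OF \<theta>] by (metis less_irrefl neg_equal_0_iff_equal)
    qed (use that in auto)
    then show ?thesis
      using p_pos by (simp add: reflect elliptic_integral_corner)
  qed
  show ?thesis
    using upper[of \<theta>] upper[of "pi - \<theta>"] reflect[of \<theta>] assms by simp
qed

text \<open>The right and top arcs together with their negatives cover the circle. An argument
  outside [-t, pi - t] is moved into this interval by a shift by pi.\<close>

lemma sphere_cases:
  assumes "norm u = 1"
  obtains \<theta> where "u = cis \<theta> \<or> u = - cis \<theta>" "\<bar>\<theta>\<bar> \<le> t \<or> t \<le> \<theta> \<and> \<theta> \<le> pi - t"
proof -
  have u: "cis (Arg u) = u" using assms cis_Arg[of u] by (cases "u = 0") (auto simp: sgn_div_norm)
  have "- cis (\<theta> - pi) = cis \<theta>" "- cis (\<theta> + pi) = cis \<theta>" for \<theta>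
    by (simp_all add: complex_eq_iff)
  then have shift: "u = - cis (Arg u - pi)" "u = - cis (Arg u + pi)"
    using u by metis+
  have bounds: "- pi < Arg u" "Arg u \<le> pi" using Arg_bounded by auto
  consider "Arg u < - t" | "- t \<le> Arg u" "Arg u \<le> pi - t" | "Arg u > pi - t" by linarith
  then show ?thesis
  proof cases
    case 1
    then have "\<bar>Arg u + pi\<bar> \<le> t \<or> t \<le> Arg u + pi \<and> Arg u + pi \<le> pi - t"
      using bounds by linarith
    then show ?thesis using that shift by blast
  next
    case 2
    then have "\<bar>Arg u\<bar> \<le> t \<or> t \<le> Arg u \<and> Arg u \<le> pi - t"
      by linarith
    then show ?thesis using that u by metis
  next
    case 3
    then have "\<bar>Arg u - pi\<bar> \<le> t"
      using bounds by linarith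
    then show ?thesis using that shift by blast
  qed
qed

lemma elliptic_integral_sphere:
  assumes "norm u = 1"
  shows "\<bar>Re (elliptic_integral t u)\<bar> \<le> p \<and> \<bar>Im (elliptic_integral t u)\<bar> \<le> q"
proof -
  obtain \<theta> where \<theta>: "u = cis \<theta> \<or> u = - cis \<theta>" "\<bar>\<theta>\<bar> \<le> t \<or> t \<le> \<theta> \<and> \<theta> \<le> pi - t"
    using sphere_cases[OF assms] .
  have "\<bar>Re (elliptic_integral t (cis \<theta>))\<bar> \<le> p \<and> \<bar>Im (elliptic_integral t (cis \<theta>))\<bar> \<le> q"
    using \<theta>(2) Re_elliptic_integral_right_arc[of \<theta>] abs_Im_elliptic_integral_right_arc[of \<theta>]
      Im_elliptic_integral_top_arc[of \<theta>] abs_Re_elliptic_integral_top_arc[of \<theta>] p_pos q_pos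
    by auto
  then show ?thesis using \<theta>(1) by (auto simp: elliptic_integral_minus)
qed

lemma elliptic_integral_cball:
  assumes u: "u \<in> cball 0 1"
  shows "\<bar>Re (elliptic_integral t u)\<bar> \<le> p" "\<bar>Im (elliptic_integral t u)\<bar> \<le> q"
proof -
  \<comment> \<open>The maximum principle for real parts bounds all four directions at once: the
    multipliers 1, -1, -i, i give Re, -Re, Im and -Im.\<close>
  have rot: "Re (c * elliptic_integral t u) \<le> B"
    if "\<And>v. norm v = 1 \<Longrightarrow> Re (c * elliptic_integral t v) \<le> B" for c B
  proof (rule maximum_real_frontier[where S = "cball 0 1" and f = "\<lambda>v. c * elliptic_integral t v"])
    show "(\<lambda>v. c * elliptic_integral t v) holomorphic_on interior (cball 0 1)"
      using ball_subset_slit_plane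
      by (auto intro!: holomorphic_intros holomorphic_on_subset[OF elliptic_integral_holomorphic])
    show "continuous_on (closure (cball 0 1)) (\<lambda>v. c * elliptic_integral t v)"
      using elliptic_integral_continuous by (auto intro!: continuous_intros)
  qed (use that u in auto)
  have sphere: "Re (elliptic_integral t v) \<le> p" "- Re (elliptic_integral t v) \<le> p"
    "Im (elliptic_integral t v) \<le> q" "- Im (elliptic_integral t v) \<le> q" if "norm v = 1" for v
    using elliptic_integral_sphere[OF that] by linarith+
  show "\<bar>Re (elliptic_integral t u)\<bar> \<le> p"
    using rot[of 1 p] rot[of "- 1" p] sphere by simp
  show "\<bar>Im (elliptic_integral t u)\<bar> \<le> q"
    using rot[of "- \<i>" q] rot[of \<i> q] sphere by simp
qed

end

section \<open>Comparison on the unit circle\<close>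

context quartic_angle
begin

lemma elliptic_integral_nonzero: "u \<in> cball 0 1 \<Longrightarrow> u \<noteq> 0 \<Longrightarrow> elliptic_integral t u \<noteq> 0"
  using Re_elliptic_integral_div_pos[of u] by auto

section \<open>The expansion at the origin\<close>

text \<open>The remainder D after the cubic term has derivative u^2 (k u - c) with k tending to c,
  so the mean value inequality gives D = o(u^3) without a power series.\<close>

lemma elliptic_integral_cubic_term:
  "((\<lambda>u. (elliptic_integral t u - u) / u ^ 3) \<longlongrightarrow> of_real (cos (2 * t)) / 3) (at 0)"
proof -
  define c :: complex where "c = of_real (cos (2 * t))"
  \<comment> \<open>Chosen so that 1/s - 1 = u^2 k(u) for the root s, by rationalising with 1 + s
    and using 1 - s^2 = u^2 (2c - u^2). Since s = 1 at the origin, k takes the value c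
    there.\<close>
  define k where "k = (\<lambda>u. (2 * c - u ^ 2) / (sqrt_quartic t u * (1 + sqrt_quartic t u)))"
  define D where "D = (\<lambda>u. elliptic_integral t u - u - c * u ^ 3 / 3)"
  have k_eq: "1 / sqrt_quartic t u - 1 - c * u ^ 2 = u ^ 2 * (k u - c)" if u: "u \<in> ball 0 1" for u
  proof -
    define s where "s = sqrt_quartic t u"
    have s: "Re s > 0" using Re_sqrt_quartic_pos[OF u] by (simp add: s_def)
    then have "s \<noteq> 0" "1 + s \<noteq> 0" by (auto simp: complex_eq_iff)
    moreover have "s ^ 2 = u ^ 4 - 2 * c * u ^ 2 + 1"
      unfolding s_def sqrt_quartic_power2 by (simp add: quartic_def c_def)
    then have "1 - s ^ 2 = u ^ 2 * (2 * c - u ^ 2)"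
      by (simp add: algebra_simps power2_eq_square power4_eq_xxxx)
    then have "(1 - s) * (1 + s) = u ^ 2 * (2 * c - u ^ 2)"
      by (simp add: algebra_simps power2_eq_square)
    moreover have "1 / s - 1 = (1 - s) * (1 + s) / (s * (1 + s))"
      using \<open>s \<noteq> 0\<close> \<open>1 + s \<noteq> 0\<close> by (simp add: diff_divide_distrib)
    ultimately have "1 / s - 1 = u ^ 2 * ((2 * c - u ^ 2) / (s * (1 + s)))"
      by simp
    then show ?thesis by (simp add: k_def s_def right_diff_distrib)
  qed
  have cont: "isCont (sqrt_quartic t) 0"
    using sqrt_quartic_holomorphic[of t] ball_subset_slit_plane[of t]
    by (metis centre_in_ball continuous_on_eq_continuous_at holomorphic_on_imp_continuous_on
        open_slit_plane subsetD zero_less_one)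
  have "isCont k 0"
    unfolding k_def using cont by (intro continuous_intros) (auto simp: sqrt_quartic_zero)
  then have klim: "(k \<longlongrightarrow> c) (at 0)"
    by (simp add: isCont_def k_def sqrt_quartic_zero)
  have D_deriv: "(D has_field_derivative u ^ 2 * (k u - c)) (at u)" if u: "u \<in> ball 0 1" for u
  proof -
    have "(D has_field_derivative 1 / sqrt_quartic t u - 1 - c * u ^ 2) (at u)"
      unfolding D_def
      using u ball_subset_slit_plane[of t]
      by (auto intro!: derivative_eq_intros elliptic_integral_has_field_derivative)
    then show ?thesis using k_eq[OF u] by simp
  qed
  have "((\<lambda>u. D u / u ^ 3) \<longlongrightarrow> 0) (at 0)"
  proof (rule LIM_I)
    fix e :: real assume e: "e > 0"
    have "\<forall>\<^sub>F u in at 0. dist (k u) c < e / 2"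
      using klim e by (auto dest: tendstoD[of _ _ _ "e / 2"])
    then obtain d where d: "d > 0" "\<And>u. u \<noteq> 0 \<Longrightarrow> dist u 0 < d \<Longrightarrow> dist (k u) c < e / 2"
      unfolding eventually_at by blast
    have "norm (D u / u ^ 3 - 0) < e" if u: "u \<noteq> 0 \<and> norm (u - 0) < min d 1" for u
    proof -
      have "norm (D u - D 0) \<le> (norm u ^ 2 * (e / 2)) * norm (u - 0)"
      proof (rule field_differentiable_bound[where S = "cball 0 (norm u)"])
        fix v :: complex assume v: "v \<in> cball 0 (norm u)"
        then have "v \<in> ball 0 1" using u by auto
        then show "(D has_field_derivative v ^ 2 * (k v - c)) (at v within cball 0 (norm u))"
          by (rule has_field_derivative_at_within[OF D_deriv])
        show "norm (v ^ 2 * (k v - c)) \<le> norm u ^ 2 * (e / 2)"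
        proof (cases "v = 0")
          case False
          then have "dist (k v) c < e / 2" using v u by (intro d(2)) auto
          then have "norm (k v - c) \<le> e / 2" by (simp add: dist_norm)
          then show ?thesis
            unfolding norm_mult norm_power using v by (intro mult_mono power_mono) auto
        qed (use e in auto)
      qed auto
      also have "\<dots> = (e / 2) * norm (u ^ 3)"
        by (simp add: norm_mult power2_eq_square power3_eq_cube)
      finally have "norm (D u) \<le> (e / 2) * norm (u ^ 3)"
        by (simp add: D_def elliptic_integral_zero)
      then have "norm (D u / u ^ 3) \<le> e / 2"
        using u by (simp add: norm_divide divide_le_eq)
      then show ?thesis using e by simp
    qed
    then show "\<exists>s>0. \<forall>u. u \<noteq> 0 \<and> norm (u - 0) < s \<longrightarrow> norm (D u / u ^ 3 - 0) < e"
      using d(1) by (intro exI[of _ "min d 1"]) auto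
  qed
  then have "((\<lambda>u. D u / u ^ 3 + c / 3) \<longlongrightarrow> 0 + c / 3) (at 0)"
    by (intro tendsto_intros)
  moreover have "D u / u ^ 3 + c / 3 = (elliptic_integral t u - u) / u ^ 3" if "u \<noteq> 0" for u
    using that by (simp add: D_def diff_divide_distrib)
  then have "\<forall>\<^sub>F u in at 0. D u / u ^ 3 + c / 3 = (elliptic_integral t u - u) / u ^ 3"
    unfolding eventually_at by (intro exI[of _ 1]) simp
  ultimately have "((\<lambda>u. (elliptic_integral t u - u) / u ^ 3) \<longlongrightarrow> 0 + c / 3) (at 0)"
    by (rule Lim_transform_eventually)
  then show ?thesis
    by (simp add: c_def)
qed

text \<open>Writing E = u (1 + u^2 m) with m tending to c/3, the poles cancel and leave -m (2 + u^2
  m) / (1 + u^2 m)^2.\<close>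

lemma inverse_square_difference:
  "((\<lambda>u. 1 / elliptic_integral t u ^ 2 - 1 / u ^ 2) \<longlongrightarrow> - (2 / 3 * of_real (cos (2 * t)))) (at 0)"
proof -
  define c :: complex where "c = of_real (cos (2 * t))"
  define m where "m = (\<lambda>u. (elliptic_integral t u - u) / u ^ 3)"
  have m: "(m \<longlongrightarrow> c / 3) (at 0)"
    unfolding m_def c_def by (rule elliptic_integral_cubic_term)
  have "((\<lambda>u. - m u * (2 + u ^ 2 * m u) / (1 + u ^ 2 * m u) ^ 2) \<longlongrightarrow>
      - (c / 3) * (2 + 0 ^ 2 * (c / 3)) / (1 + 0 ^ 2 * (c / 3)) ^ 2) (at 0)"
    by (intro tendsto_intros m) auto
  moreover have "- m u * (2 + u ^ 2 * m u) / (1 + u ^ 2 * m u) ^ 2 = 1 / elliptic_integral t u ^ 2 - 1 / u ^ 2"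
    if u: "u \<noteq> 0" "dist u 0 < 1" for u
  proof -
    have E0: "elliptic_integral t u \<noteq> 0" using elliptic_integral_nonzero[of u] u by auto
    have E: "elliptic_integral t u = u * (1 + u ^ 2 * m u)"
      using u by (simp add: m_def field_simps power2_eq_square power3_eq_cube)
    have "1 + u ^ 2 * m u \<noteq> 0" using E0 E by auto
    then show ?thesis
      unfolding E using u(1)
      by (simp add: divide_simps) (simp add: power2_eq_square algebra_simps)
  qed
  then have "\<forall>\<^sub>F u in at 0. - m u * (2 + u ^ 2 * m u) / (1 + u ^ 2 * m u) ^ 2
      = 1 / elliptic_integral t u ^ 2 - 1 / u ^ 2"
    unfolding eventually_at by (intro exI[of _ 1]) auto
  ultimately have "((\<lambda>u. 1 / elliptic_integral t u ^ 2 - 1 / u ^ 2) \<longlongrightarrow>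
      - (c / 3) * (2 + 0 ^ 2 * (c / 3)) / (1 + 0 ^ 2 * (c / 3)) ^ 2) (at 0)"
    by (rule Lim_transform_eventually)
  moreover have "- (c / 3) * (2 + 0 ^ 2 * (c / 3)) / (1 + 0 ^ 2 * (c / 3)) ^ 2 = - (2 / 3 * c)"
    by simp
  ultimately show ?thesis
    unfolding c_def by metis
qed

section \<open>Identification of the Weierstrass function composed with E\<close>

sublocale rectangular_lattice p q
  by standard (rule p_pos q_pos)+

lemma elliptic_integral_in_wide_rectangle:
  "u \<in> cball 0 1 \<Longrightarrow> elliptic_integral t u \<in> wide_rectangle"
  using elliptic_integral_cball[of u] p_pos q_pos by (simp add: wide_rectangle_def)

text \<open>Up to sign, u lies on the right or the top arc, whose images lie on a vertical and a
  horizontal side of the rectangle. Evenness of \<open>wp\<close> absorbs the sign.\<close>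

lemma wp_elliptic_integral_real:
  assumes "norm u = 1"
  shows "wp (elliptic_integral t u) \<in> \<real>"
proof -
  obtain \<theta> where \<theta>: "u = cis \<theta> \<or> u = - cis \<theta>" "\<bar>\<theta>\<bar> \<le> t \<or> t \<le> \<theta> \<and> \<theta> \<le> pi - t"
    using sphere_cases[OF assms] .
  have "wp (elliptic_integral t (cis \<theta>)) \<in> \<real>"
    using \<theta>(2) Re_elliptic_integral_right_arc[of \<theta>] abs_Im_elliptic_integral_right_arc[of \<theta>]
      Im_elliptic_integral_top_arc[of \<theta>] abs_Re_elliptic_integral_top_arc[of \<theta>]
      wp_real_on_vertical_side wp_real_on_horizontal_side by blast
  then show ?thesis
    using \<theta>(1) wp_minus[OF elliptic_integral_in_wide_rectangle[of "cis \<theta>"]]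
    by (auto simp: elliptic_integral_minus)
qed

lemma wp_elliptic_integral:
  assumes "u \<in> cball 0 1" "u \<noteq> 0"
  shows "wp (elliptic_integral t u) = u ^ 2 + 1 / u ^ 2 - 2 / 3 * of_real (cos (2 * t))"
proof -
  define c :: complex where "c = - (2 / 3 * of_real (cos (2 * t)))"
  \<comment> \<open>The difference of the two poles, with its limit inserted at 0. Adding the
    regular part and subtracting u^2 then gives the function that is to be shown constant.\<close>
  define r where "r = (\<lambda>u. if u = 0 then c else 1 / elliptic_integral t u ^ 2 - 1 / u ^ 2)"
  define h where "h = (\<lambda>u. r u + regular_part (elliptic_integral t u) - u ^ 2)"
  have h_eq: "h u = wp (elliptic_integral t u) - (u ^ 2 + 1 / u ^ 2)" if "u \<noteq> 0" for u
    using that by (simp add: h_def r_def wp_eq_regular_part)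
  have h0: "h 0 = c"
    by (simp add: h_def r_def elliptic_integral_zero regular_part_zero)
  have r_cont: "continuous_on (cball 0 1) r"
    unfolding continuous_on_def
  proof
    fix x :: complex assume x: "x \<in> cball 0 1"
    show "(r \<longlongrightarrow> r x) (at x within cball 0 1)"
    proof (cases "x = 0")
      case True
      have "(r \<longlongrightarrow> c) (at 0)"
        using inverse_square_difference unfolding c_def[symmetric]
        by (rule Lim_transform_eventually) (auto simp: r_def eventually_at intro!: exI[of _ 1])
      then show ?thesis
        using True by (simp add: r_def tendsto_within_subset[of _ _ _ UNIV])
    next
      case False
      have "continuous_on (cball 0 1 - {0}) (\<lambda>u. 1 / elliptic_integral t u ^ 2 - 1 / u ^ 2)"
        using elliptic_integral_nonzero
        by (intro continuous_intros continuous_on_subset[OF elliptic_integral_continuous]) auto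
      then have "continuous_on (cball 0 1 - {0}) r"
        by (rule continuous_on_eq) (auto simp: r_def)
      then have "(r \<longlongrightarrow> r x) (at x within (cball 0 1 - {0}))"
        using x False by (auto simp: continuous_on_def)
      moreover have "at x within (cball 0 1 - {0}) = at x within cball 0 1"
        by (rule at_within_nhd[where S = "- {0}"]) (use False in auto)
      ultimately show ?thesis by simp
    qed
  qed
  have h_cont: "continuous_on (cball 0 1) h"
    unfolding h_def
    by (intro continuous_intros r_cont continuous_on_compose2[OF
          holomorphic_on_imp_continuous_on[OF regular_part_holomorphic] elliptic_integral_continuous])
      (use elliptic_integral_in_wide_rectangle in auto)
  have h_hol: "h holomorphic_on ball 0 1"
  \<comment> \<open>Continuity of \<open>h\<close> at 0 makes the singularity there
    removable.\<close>
  proof (rule no_isolated_singularity[where K = "{0}"])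
    have ell: "elliptic_integral t holomorphic_on (ball 0 1 - {0})"
      using ball_subset_slit_plane by (blast intro: holomorphic_on_subset[OF elliptic_integral_holomorphic])
    have reg: "(regular_part \<circ> elliptic_integral t) holomorphic_on (ball 0 1 - {0})"
      using elliptic_integral_in_wide_rectangle
      by (intro holomorphic_on_compose_gen[OF ell regular_part_holomorphic]) auto
    have "(\<lambda>u. 1 / elliptic_integral t u ^ 2 - 1 / u ^ 2
        + (regular_part \<circ> elliptic_integral t) u - u ^ 2) holomorphic_on (ball 0 1 - {0})"
      using elliptic_integral_nonzero by (intro holomorphic_intros ell reg) auto
    then show "h holomorphic_on (ball 0 1 - {0})"
      by (rule holomorphic_transform) (simp add: h_def r_def)
  qed (use h_cont in \<open>auto intro: continuous_on_subset\<close>)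
  have h_real: "h v \<in> \<real>" if v: "norm v = 1" for v
  proof -
    have "cnj v = 1 / v"
      using v complex_norm_square[of v] by (auto simp: eq_divide_eq mult.commute)
    then have "v ^ 2 + 1 / v ^ 2 = v ^ 2 + cnj (v ^ 2)" by (simp add: power_divide)
    also have "\<dots> \<in> \<real>" by (simp only: complex_add_cnj Reals_of_real)
    finally have "v ^ 2 + 1 / v ^ 2 \<in> \<real>" .
    moreover have "v \<noteq> 0" using v by auto
    ultimately show ?thesis
      using wp_elliptic_integral_real[OF v] by (simp add: h_eq)
  qed
  \<comment> \<open>The two multipliers bound Im h by 0 from both sides.\<close>
  have rot: "Re (a * h v) \<le> 0" if "a = \<i> \<or> a = - \<i>" "v \<in> cball 0 1" for a v
  proof (rule maximum_real_frontier[where S = "cball 0 1" and f = "\<lambda>v. a * h v"])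
    show "(\<lambda>v. a * h v) holomorphic_on interior (cball 0 1)"
      using h_hol by (auto intro!: holomorphic_intros)
    show "continuous_on (closure (cball 0 1)) (\<lambda>v. a * h v)"
      using h_cont by (auto intro!: continuous_intros)
    show "Re (a * h z) \<le> 0" if "z \<in> frontier (cball 0 1)" for z
      using h_real[of z] that \<open>a = \<i> \<or> a = - \<i>\<close> by (auto simp: complex_is_Real_iff)
  qed (use that in auto)
  have Im_h: "Im (h v) = 0" if "v \<in> cball 0 1" for v
    using rot[of \<i> v] rot[of "- \<i>" v] that by simp
  \<comment> \<open>A nonconstant holomorphic function would have an open image, but the image lies
    in the real line.\<close>
  have h_const: "h constant_on ball 0 1"
  proof (rule ccontr)
    assume "\<not> h constant_on ball 0 1"
    then have "open (h ` ball 0 1)"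
      by (intro open_mapping_thm[OF h_hol]) auto
    then have "interior (h ` ball 0 1) \<noteq> {}"
      by (simp add: interior_open)
    moreover have "h ` ball 0 1 \<subseteq> {z. Im z = 0}"
      using Im_h by auto
    then have "interior (h ` ball 0 1) \<subseteq> interior {z. Im z = 0}"
      by (rule interior_mono)
    moreover have "interior {z. Im z = 0} = {}"
      using interior_hyperplane[of \<i> 0] by simp
    ultimately show False
      by simp
  qed
  \<comment> \<open>Constancy is extended to the circle, where the evaluation points 1, i and
    \<open>cis t\<close> lie.\<close>
  have "h v = c" if "v \<in> cball 0 1" for v
  proof -
    have "h v = c" if "v \<in> ball 0 1" for v
      using h_const h0 that by (metis constant_on_def centre_in_ball zero_less_one)
    then show ?thesis
      using continuous_constant_on_closure[of "ball 0 1" h c v] h_cont that by simp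
  qed
  then show ?thesis
    using assms h_eq[of u] by (simp add: c_def algebra_simps)
qed

end

theorem mainTheorem1:
  fixes t :: real and \<omega>\<^sub>1 \<omega>\<^sub>2 \<omega>\<^sub>3 e\<^sub>1 e\<^sub>2 e\<^sub>3 :: complex
  assumes "0 < t" and "t < pi / 2"
    and "\<omega>\<^sub>1 = E t 1" and "\<omega>\<^sub>2 = E t \<i>" and "\<omega>\<^sub>3 = \<omega>\<^sub>1 + \<omega>\<^sub>2"
    and "e\<^sub>1 = weierstrass_p (2 * \<omega>\<^sub>1) (2 * \<omega>\<^sub>2) \<omega>\<^sub>1"
    and "e\<^sub>2 = weierstrass_p (2 * \<omega>\<^sub>1) (2 * \<omega>\<^sub>2) \<omega>\<^sub>2"
    and "e\<^sub>3 = weierstrass_p (2 * \<omega>\<^sub>1) (2 * \<omega>\<^sub>2) \<omega>\<^sub>3"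
  shows "e\<^sub>1 = 2 - 2 / 3 * of_real (cos (2 * t)) \<and>
         e\<^sub>2 = - 2 - 2 / 3 * of_real (cos (2 * t)) \<and>
         e\<^sub>3 = 4 / 3 * of_real (cos (2 * t))"
proof -
  interpret quartic_angle t
    using assms(1,2) by unfold_locales
  \<comment> \<open>All three half-periods become values of E on the unit circle, the third one
    through the corner of the rectangle.\<close>
  have \<omega>: "\<omega>\<^sub>1 = elliptic_integral t 1" "\<omega>\<^sub>2 = elliptic_integral t \<i>"
    "\<omega>\<^sub>3 = elliptic_integral t (cis t)"
    using assms(3-5)
    by (simp_all add: E_eq_elliptic_integral elliptic_integral_one elliptic_integral_i
        elliptic_integral_corner)
  have "weierstrass_p (2 * \<omega>\<^sub>1) (2 * \<omega>\<^sub>2) = wp"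
    unfolding wp_def \<omega> elliptic_integral_one elliptic_integral_i ..
  then have e: "e\<^sub>1 = wp (elliptic_integral t 1)" "e\<^sub>2 = wp (elliptic_integral t \<i>)"
    "e\<^sub>3 = wp (elliptic_integral t (cis t))"
    using assms(6-8) \<omega> by simp_all
  have "cis t ^ 2 + 1 / cis t ^ 2 = cis (2 * t) + cis (- (2 * t))"
    by (simp add: Complex.DeMoivre cis_inverse flip: inverse_eq_divide)
  also have "\<dots> = 2 * of_real (cos (2 * t))"
    by (simp add: complex_eq_iff)
  finally have "cis t ^ 2 + 1 / cis t ^ 2 = 2 * of_real (cos (2 * t))" .
  \<comment> \<open>The value is 2 cos 2t - (2/3) cos 2t.\<close>
  then have "e\<^sub>3 = 4 / 3 * of_real (cos (2 * t))"
    unfolding e by (subst wp_elliptic_integral) auto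
  moreover have "e\<^sub>1 = 2 - 2 / 3 * of_real (cos (2 * t))"
    unfolding e by (subst wp_elliptic_integral) auto
  moreover have "e\<^sub>2 = - 2 - 2 / 3 * of_real (cos (2 * t))"
    unfolding e by (subst wp_elliptic_integral) auto
  ultimately show ?thesis by blast
qed

end
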